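(* Let $p$ be a prime, $q=p^l$, $n\ge 2$ and $k\ge 1$ integers with $p\nmid k$. For $m\in\mathbb N$ let $d_m=\gcd(k,q^m-1)$ and $d=d_1$. If \[q\ge \max\left\{\sqrt{(d-1)^6+6d},\ (d_2-1)^2+1,\ \lfloor (d_3-1)^{4/3}\rfloor+1\right\},\] then every matrix in $M_n(\mathbb F_q)$ is of the form $A^k+B^k$ with $A,B\in M_n(\mathbb F_q)$. *)

theory Defs
  imports Complex_Main "HOL-Library.Cardinality" "HOL-Computational_Algebra.Primes"
    "Jordan_Normal_Form.Matrix"
begin

end

theory Submission
  imports Defs "HOL-Computational_Algebra.Polynomial" "HOL-Number_Theory.Cong" "HOL-Analysis.Convex"
    "Jordan_Normal_Form.Determinant"
begin

text \<open>
  A nonscalar matrix is similar to a matrix with any prescribed diagonal of the same trace. Choosing the diagonal entries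
  as sums of two nonzero \<open>k\<close>-th powers, the conjugate splits into a lower and an upper triangular matrix whose
  diagonal entries are nonzero \<open>k\<close>-th powers, and such triangular matrices have \<open>k\<close>-th roots since \<open>k\<close> is prime to \<open>p\<close>. The
  diagonal exists as soon as every element of the field is a sum of four nonzero \<open>k\<close>-th powers, which is the first bound.

  A scalar matrix is cut into blocks of size two and three. On such a block the scalar is an element of the extension of
  degree two or three, acting by multiplication, and the other two bounds make it a sum of two \<open>k\<close>-th powers there.

  Both results on sums of powers follow from estimates of the character sums \<open>g(a) = \<Sum>x. \<psi>(a x\<^sup>k)\<close>.
\<close>

section \<open>Finite fields and additive characters\<close>

text \<open>A scalar matrix has no conjugate but itself, so conjugation gains nothing there. In a
  field with \<open>Q\<close> elements two powers are shown to suffice for \<open>Q > m ^ 4\<close>;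
  with \<open>Q = q^2\<close> and \<open>Q = q^3\<close> this becomes the second and the third
  bound, both weaker in their exponent than what \<open>Q = q\<close> would require.

  For a nonscalar matrix the trace is absorbed by two diagonal entries, hence four powers. They must
  be nonzero: a triangular matrix with zeros on the diagonal may have no \<open>k\<close>-th root.
  The exponent \<open>6\<close> is \<open>(d - 1)^3 < q\<close> squared. It is the target zero that
  requires this order of growth; a nonzero target needs only about \<open>(d - 1)^(8/3) < q\<close>.
  The summand \<open>6 d\<close> removes small fields such as the one with two elements, where
  \<open>1\<close> is not a sum of four nonzero powers.\<close>

lemma power_card_minus_1_finite_field:
  fixes x :: "'a :: {field, finite}"
  assumes "x \<noteq> 0"
  shows "x ^ (CARD('a) - 1) = 1"
proof -
  have "bij_betw ((*) x) (UNIV - {0}) (UNIV - {0})"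
    using assms by (intro bij_betwI[where g = "\<lambda>y. y / x"]) auto
  then have "(\<Prod>y\<in>UNIV-{0}. x * y) = \<Prod>(UNIV-{0})"
    using prod.reindex_bij_betw[of "(*) x" "UNIV - {0}" "UNIV - {0}" "\<lambda>y. y"] by simp
  moreover have "(\<Prod>y\<in>UNIV-{0}. x * y) = x ^ (CARD('a) - 1) * \<Prod>(UNIV-{0})"
    by (simp add: prod.distrib card_Diff_singleton)
  moreover have "\<Prod>(UNIV - {0 :: 'a}) \<noteq> 0" by (simp add: prod_zero_iff)
  ultimately show ?thesis by simp
qed

lemma power_card_finite_field: "(x :: 'a :: {field, finite}) ^ CARD('a) = x"
proof (cases "x = 0")
  case False
  have "x ^ CARD('a) = x * x ^ (CARD('a) - 1)"
    by (metis Suc_pred' power_Suc zero_less_card_finite)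
  then show ?thesis using power_card_minus_1_finite_field[OF False] by simp
qed simp

text \<open>Translation by \<open>1\<close> does not change the sum of all elements, so
  \<open>CARD('a)\<close> is zero in the field and the characteristic divides
  \<open>p ^ l\<close>.\<close>

lemma CHAR_eq_of_card_prime_power:
  assumes "prime p" and "CARD('a :: {field, finite}) = p ^ l"
  shows "CHAR('a) = p"
proof -
  have 1: "CHAR('a) > 0" by (simp add: finite_imp_CHAR_pos)
  then have 2: "prime CHAR('a)" by (rule prime_CHAR_semidom)
  have "(\<Sum>x\<in>UNIV. x + 1) = (\<Sum>x\<in>UNIV. x :: 'a)"
    by (rule sum.reindex_bij_witness[where i = "\<lambda>x. x - 1" and j = "\<lambda>x. x + 1"]) auto
  then have "of_nat (CARD('a)) = (0 :: 'a)" by (simp add: sum.distrib)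
  then have "CHAR('a) dvd p ^ l" using assms(2) of_nat_eq_0_iff_char_dvd by metis
  then show ?thesis using 2 assms(1) by (metis prime_dvd_power primes_dvd_imp_eq)
qed

text \<open>\<open>X^p - X\<close> has at most \<open>p\<close> roots, and the images of the
  \<open>p\<close> numbers below \<open>p\<close> already are roots.\<close>

lemma prime_subfield_eq_fixed_points:
  fixes x :: "'a :: {field, finite}"
  assumes "prime CHAR('a)" and "x ^ CHAR('a) = x"
  shows "\<exists>j::nat. of_nat j = x"
proof -
  let ?p = "CHAR('a)"
  have p: "?p > 1" using assms(1) prime_gt_1_nat by blast
  let ?P = "monom 1 ?p - monom 1 1 :: 'a poly"
  have "coeff ?P ?p = 1" using p by simp
  then have P0: "?P \<noteq> 0" by (metis coeff_0 zero_neq_one)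
  have "degree ?P \<le> ?p" using p by (intro degree_diff_le) (auto simp: degree_monom_eq)
  then have le: "card {x. poly ?P x = 0} \<le> ?p" using card_poly_roots_bound[OF P0] by linarith
  have "inj_on (of_nat :: nat \<Rightarrow> 'a) {..<?p}"
    by (intro inj_onI) (auto simp: of_nat_eq_iff_cong_CHAR cong_def)
  then have "card (of_nat ` {..<?p} :: 'a set) = ?p" by (simp add: card_image)
  moreover have fix_nat: "(of_nat j :: 'a) ^ ?p = of_nat j" for j
    using p by (induction j) (auto simp: freshmans_dream[OF assms(1) refl] power_0_left)
  then have "of_nat ` {..<?p} \<subseteq> {x. poly ?P x = 0}" by (auto simp: poly_monom)
  ultimately have "of_nat ` {..<?p} = {x. poly ?P x = 0}"
    using le by (intro card_seteq) auto
  moreover have "x \<in> {x. poly ?P x = 0}" using assms(2) by (simp add: poly_monom)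
  ultimately have "x \<in> of_nat ` {..<?p}" by simp
  then show ?thesis by auto
qed

text \<open>The character is \<open>x \<mapsto> exp (2\<pi>i Tr x / p)\<close>, where \<open>Tr x = x + x\<^sup>p + \<dots> + x\<^sup>q\<^sup>/\<^sup>p\<close> is the absolute trace.
  The trace is not identically zero because it is a polynomial of degree less than \<open>q\<close>.\<close>

lemma ex_nontrivial_additive_character:
  assumes "prime p" and "CARD('a :: {field, finite}) = p ^ l"
  shows "\<exists>\<psi> :: 'a \<Rightarrow> complex. (\<forall>x y. \<psi> (x + y) = \<psi> x * \<psi> y) \<and> (\<forall>x. norm (\<psi> x) = 1) \<and> (\<exists>x. \<psi> x \<noteq> 1)"
proof -
  have ch: "CHAR('a) = p" by (rule CHAR_eq_of_card_prime_power[OF assms])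
  have pr: "prime CHAR('a)" using ch assms(1) by simp
  have p: "p > 1" using assms(1) prime_gt_1_nat by blast
  have "l > 0"
  proof (rule ccontr)
    assume "\<not> l > 0"
    then have "CARD('a) = 1" using assms(2) by simp
    then show False by (metis card_1_singletonE UNIV_I singletonD zero_neq_one)
  qed
  define Tr :: "'a \<Rightarrow> 'a" where "Tr x = (\<Sum>i<l. x ^ (p ^ i))" for x
  have Tr_add: "Tr (x + y) = Tr x + Tr y" for x y
    unfolding Tr_def by (simp add: freshmans_dream'[OF pr] ch sum.distrib)
  \<comment> \<open>Frobenius shifts the summands by one place, and \<open>x^q = x\<close> brings
    the last one back to the front; so the trace lies in the prime field.\<close>
  have "Tr x ^ p = Tr x" for x
  proof -
    have "Tr x ^ p = (\<Sum>i<l. x ^ (p ^ Suc i))"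
      unfolding Tr_def by (simp add: freshmans_dream_sum[OF pr] ch power_mult[symmetric] mult.commute)
    also have "\<dots> = (\<Sum>i<Suc l. x ^ (p ^ i)) - x" by (subst sum.lessThan_Suc_shift) simp
    also have "\<dots> = Tr x"
      unfolding Tr_def using power_card_finite_field[of x] assms(2) by simp
    finally show ?thesis .
  qed
  then have "\<forall>x. \<exists>j::nat. of_nat j = Tr x"
    using prime_subfield_eq_fixed_points[OF pr] ch by simp
  then obtain f :: "'a \<Rightarrow> nat" where f: "\<And>x. of_nat (f x) = Tr x" by metis
  define P :: "'a poly" where "P = (\<Sum>i<l. monom 1 (p ^ i))"
  have "\<exists>x. Tr x \<noteq> 0"
  proof (rule ccontr)
    assume "\<not> ?thesis"
    then have "{x. poly P x = 0} = UNIV" by (auto simp: P_def Tr_def poly_sum poly_monom)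
    moreover have "coeff P 1 = 1"
    proof -
      have "coeff P 1 = (\<Sum>i<l. if i = 0 then 1 else 0)"
        unfolding P_def coeff_sum using p by (intro sum.cong) auto
      then show ?thesis using \<open>l > 0\<close> by simp
    qed
    then have "P \<noteq> 0" by (metis coeff_0 zero_neq_one)
    then have "card {x. poly P x = 0} \<le> degree P" by (rule card_poly_roots_bound)
    moreover have "degree P \<le> p ^ (l - 1)"
      unfolding P_def using p
      by (intro degree_sum_le) (auto simp: degree_monom_eq intro!: power_increasing)
    moreover have "p ^ (l - 1) < p ^ l" using p \<open>l > 0\<close> by (intro power_strict_increasing) auto
    ultimately show False using assms(2) by simp
  qed
  then obtain z where z: "Tr z \<noteq> 0" by blast
  define \<psi> where "\<psi> x = cis (2 * pi * f x / p)" for x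
  \<comment> \<open>\<open>f\<close> picks arbitrary representatives of the trace modulo
    \<open>p\<close>, so additivity of \<open>\<psi>\<close> rests on this periodicity.\<close>
  have cis_cong: "cis (2 * pi * i / p) = cis (2 * pi * j / p)" if "[i = j] (mod p)" for i j :: nat
  proof -
    have *: "cis (2 * pi * i / p) = cis (2 * pi * (i mod p) / p)" for i :: nat
    proof -
      have "2 * pi * i / p = 2 * pi * (i mod p) / p + 2 * pi * (i div p)"
      proof -
        have "real i = real (i mod p) + real p * real (i div p)"
          by (metis add.commute mod_mult_div_eq of_nat_add of_nat_mult)
        then show ?thesis using p by (simp add: field_simps)
      qed
      then have "cis (2 * pi * i / p) = cis (2 * pi * (i mod p) / p) * cis (2 * pi * (i div p))"
        by (simp only: cis_mult)
      then show ?thesis using cis_multiple_2pi[of "real (i div p)"] by simp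
    qed
    show ?thesis using that *[of i] *[of j] by (simp add: cong_def)
  qed
  have "\<psi> (x + y) = \<psi> x * \<psi> y" for x y
  proof -
    have "of_nat (f (x + y)) = (of_nat (f x + f y) :: 'a)" by (simp add: f Tr_add)
    then have "[f (x + y) = f x + f y] (mod p)" by (simp only: of_nat_eq_iff_cong_CHAR ch)
    then have "\<psi> (x + y) = cis (2 * pi * real (f x + f y) / p)" unfolding \<psi>_def by (rule cis_cong)
    then show ?thesis by (simp add: \<psi>_def cis_mult ring_distribs add_divide_distrib)
  qed
  moreover have "\<psi> z \<noteq> 1"
  proof
    assume "\<psi> z = 1"
    then have "cos (2 * pi * f z / p) = 1" unfolding \<psi>_def by (simp add: complex_eq_iff)
    then obtain m :: int where m: "2 * pi * f z / p = real_of_int m * 2 * pi" using cos_one_2pi_int by blast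
    then have "real (f z) = real_of_int (m * int p)" using p by (simp add: field_simps)
    then have "int (f z) = m * int p" by (metis of_int_eq_iff of_int_of_nat_eq)
    then have "p dvd f z" by (metis dvd_triv_right int_dvd_int_iff)
    then show False using z f[of z] of_nat_eq_0_iff_char_dvd[where ?'a = 'a] ch by metis
  qed
  ultimately show ?thesis by (intro exI[of _ \<psi>]) (auto simp: \<psi>_def)
qed

section \<open>Character sums over \<open>k\<close>-th powers\<close>

lemma card_Collect_pair:
  fixes P :: "'b::finite \<Rightarrow> 'c::finite \<Rightarrow> bool"
  shows "card {w. P (fst w) (snd w)} = (\<Sum>y\<in>UNIV. card {x. P x y})"
proof -
  have "{w. P (fst w) (snd w)} = (\<lambda>(y, x). (x, y)) ` (SIGMA y:UNIV. {x. P x y})" by force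
  also have "card \<dots> = card (SIGMA y:UNIV. {x. P x y})" by (rule card_image) (auto simp: inj_on_def)
  finally show ?thesis by simp
qed

text \<open>The numbers \<open>Q\<close> and \<open>e\<close> depend on the type only, hence they are parameters rather than definitions of the locale.\<close>

locale kth_power_sums =
  fixes \<psi> :: "'a :: {field, finite} \<Rightarrow> complex" and k :: nat and Q :: real and e :: nat
  assumes psi_add: "\<psi> (x + y) = \<psi> x * \<psi> y"
    and norm_psi: "norm (\<psi> x) = 1"
    and psi_nontrivial: "\<exists>x. \<psi> x \<noteq> 1"
    and k_pos: "k \<ge> 1"
    and Q_def [simp]: "Q = real CARD('a)"
    and e_def: "e = card {y :: 'a. y ^ k = 1}"
begin

abbreviation U :: "'a set" where "U \<equiv> UNIV - {0}"
text \<open>The number of nontrivial multiplicative characters with trivial \<open>k\<close>-th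
  power. In the classical expansion of \<open>g a\<close> into Gauss sums each of them contributes a
  term of modulus \<open>sqrt Q\<close>.\<close>

definition m :: real where "m = real e - 1"
definition g :: "'a \<Rightarrow> complex" where "g a = (\<Sum>x\<in>UNIV. \<psi> (a * x ^ k))"
text \<open>Leaving out \<open>x = 0\<close> makes products of \<open>\<tau>\<close> count solutions
  in nonzero powers.\<close>

definition \<tau> :: "'a \<Rightarrow> complex" where "\<tau> a = (\<Sum>x\<in>U. \<psi> (a * x ^ k))"

lemma k_gt_0 [simp]: "0 < k"
  using k_pos by simp

lemma zero_power_k [simp]: "(0 :: 'a) ^ k = 0"
  by (rule zero_power) simp

lemma psi_0: "\<psi> 0 = 1"
  using psi_add[of 0 0] norm_psi[of 0] by auto

lemma psi_uminus: "\<psi> (- x) = cnj (\<psi> x)"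
proof -
  have "\<psi> x * \<psi> (- x) = 1" using psi_add[of x "- x"] psi_0 by simp
  moreover have "\<psi> x * cnj (\<psi> x) = 1" using norm_psi[of x] by (simp add: complex_norm_square[symmetric])
  moreover have "\<psi> x \<noteq> 0" using norm_psi[of x] by auto
  ultimately show ?thesis by (metis mult_left_cancel)
qed

lemma card_U: "real (card U) = Q - 1"
  by (simp add: card_Diff_singleton of_nat_diff Suc_le_eq)

lemma Q_gt_1: "Q > 1"
proof -
  have "card {0, 1 :: 'a} \<le> CARD('a)" by (intro card_mono) auto
  then show ?thesis by simp
qed

lemma sum_psi_mult: "(\<Sum>a\<in>UNIV. \<psi> (a * t)) = (if t = 0 then of_real Q else 0)"
proof (cases "t = 0")
  case False
  obtain z where z: "\<psi> z \<noteq> 1" using psi_nontrivial by blast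
  have "(\<Sum>a\<in>UNIV. \<psi> (a * t)) = (\<Sum>a\<in>UNIV. \<psi> ((a + z / t) * t))"
    by (rule sum.reindex_bij_witness[where i = "\<lambda>a. a + z / t" and j = "\<lambda>a. a - z / t"]) auto
  also have "\<dots> = \<psi> z * (\<Sum>a\<in>UNIV. \<psi> (a * t))"
    using False by (simp add: distrib_right psi_add flip: sum_distrib_left sum_distrib_right)
  finally show ?thesis using z False by simp
qed (simp add: psi_0)

text \<open>Orthogonality: for fixed \<open>v\<close> the sum over \<open>a\<close> detects whether
  \<open>f v = 0\<close>.\<close>

lemma card_solutions:
  assumes "finite S"
  shows "(\<Sum>a\<in>UNIV. \<Sum>v\<in>S. \<psi> (a * f v)) = of_real (Q * real (card {v \<in> S. f v = 0}))"
proof -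
  have "(\<Sum>a\<in>UNIV. \<Sum>v\<in>S. \<psi> (a * f v)) = (\<Sum>v\<in>S. \<Sum>a\<in>UNIV. \<psi> (a * f v))" by (rule sum.swap)
  also have "\<dots> = (\<Sum>v\<in>S. if f v = 0 then of_real Q else 0)" by (simp add: sum_psi_mult)
  also have "\<dots> = of_real (Q * real (card {v \<in> S. f v = 0}))"
    using assms by (simp add: sum.If_cases Int_def mult.commute)
  finally show ?thesis .
qed

text \<open>Brings a product of sums into the shape required by \<open>card_solutions\<close>.
  Iteration nests the pairs, hence the chains of \<open>fst\<close> and \<open>snd\<close> further
  on.\<close>

lemma psi_sum_mult:
  "(\<Sum>u\<in>A. \<psi> (a * f u)) * (\<Sum>v\<in>B. \<psi> (a * h v)) = (\<Sum>w\<in>A \<times> B. \<psi> (a * (f (fst w) + h (snd w))))"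
  by (simp add: sum_product sum.cartesian_product psi_add distrib_left case_prod_beta)

lemma sum_UNIV_eq: "(\<Sum>a\<in>UNIV. f a) = f 0 + (\<Sum>a\<in>U. f a)" for f :: "'a \<Rightarrow> 'b::comm_monoid_add"
  by (rule sum.remove) auto

lemma g_0: "g 0 = of_real Q"
  by (simp add: g_def psi_0)

lemma \<tau>_eq: "\<tau> a = g a - 1"
  unfolding g_def \<tau>_def sum_UNIV_eq by (simp add: psi_0)

lemma \<tau>_0: "\<tau> 0 = of_real (Q - 1)"
  by (simp add: \<tau>_eq g_0)

lemma g_uminus: "g (- a) = cnj (g a)"
  by (simp add: g_def psi_uminus)

text \<open>Substitute \<open>h * x\<close> for \<open>x\<close>: \<open>g\<close> is constant on
  cosets of the group of nonzero \<open>k\<close>-th powers.\<close>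

lemma g_twist: "h \<noteq> 0 \<Longrightarrow> g (a * h ^ k) = g a"
  unfolding g_def
  by (rule sum.reindex_bij_witness[where j = "\<lambda>x. h * x" and i = "\<lambda>x. x / h"])
    (auto simp: power_mult_distrib power_divide mult.assoc)

lemma sum_U_scale: "c \<noteq> 0 \<Longrightarrow> (\<Sum>a\<in>U. f (c * a)) = (\<Sum>a\<in>U. f a)" for f :: "'a \<Rightarrow> 'b::comm_monoid_add"
  by (rule sum.reindex_bij_witness[where j = "\<lambda>x. c * x" and i = "\<lambda>x. x / c"]) auto

lemma card_fibre: "y \<noteq> 0 \<Longrightarrow> card {x :: 'a. x ^ k = y ^ k} = e"
  unfolding e_def
  by (rule bij_betw_same_card[of "\<lambda>x. x / y"], rule bij_betwI[where g = "\<lambda>x. x * y"])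
    (auto simp: power_mult_distrib power_divide)

lemma e_pos: "e \<ge> 1"
proof -
  have "card {1 :: 'a} \<le> e" unfolding e_def by (intro card_mono) auto
  then show ?thesis by simp
qed

lemma m_nonneg: "m \<ge> 0"
  using e_pos by (simp add: m_def)

text \<open>Since \<open>x ^ k = 0\<close> only for \<open>x = 0\<close>, the sum over all
  \<open>a\<close> is \<open>Q\<close>, which is the single term \<open>g 0\<close>.\<close>

lemma sum_g: "(\<Sum>a\<in>U. g a) = 0"
proof -
  have "(\<Sum>a\<in>UNIV. g a) = of_real (Q * real (card {x::'a. x ^ k = 0}))"
    unfolding g_def using card_solutions[of UNIV "\<lambda>x. x ^ k"] by simp
  also have "{x::'a. x ^ k = 0} = {0}" by auto
  finally show ?thesis by (simp add: sum_UNIV_eq g_0)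
qed

lemma g_mult_g:
  "g (b * a) * g (c * a) = (\<Sum>w\<in>UNIV. \<psi> (a * (b * fst w ^ k + c * snd w ^ k)))"
  using psi_sum_mult[of a "\<lambda>x. b * x ^ k" UNIV "\<lambda>x. c * x ^ k" UNIV] by (simp add: g_def ac_simps)

lemma sum_g_mult_g:
  "(\<Sum>a\<in>U. g a * g (c * a)) = of_real (Q * real (card {w. fst w ^ k + c * snd w ^ k = 0}) - Q\<^sup>2)"
proof -
  have "(\<Sum>a\<in>UNIV. g a * g (c * a)) = of_real (Q * real (card {w. fst w ^ k + c * snd w ^ k = 0}))"
    using card_solutions[of UNIV "\<lambda>w. fst w ^ k + c * snd w ^ k"] g_mult_g[of 1 _ c] by simp
  then show ?thesis by (simp add: sum_UNIV_eq g_0 power2_eq_square eq_diff_eq add.commute)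
qed

lemma card_equal_powers: "real (card {w :: 'a \<times> 'a. fst w ^ k + (- 1) * snd w ^ k = 0}) = 1 + (Q - 1) * e"
proof -
  have "card {w :: 'a \<times> 'a. fst w ^ k + (- 1) * snd w ^ k = 0} = (\<Sum>y\<in>UNIV. card {x::'a. x ^ k = y ^ k})"
    using card_Collect_pair[of "\<lambda>x y :: 'a. x ^ k = y ^ k"] by simp
  also have "real \<dots> = 1 + real (\<Sum>y\<in>U. e)"
  proof -
    have "{x::'a. x ^ k = 0} = {0}" by auto
    then show ?thesis unfolding sum_UNIV_eq using card_fibre by simp
  qed
  finally show ?thesis using card_U by simp
qed

text \<open>As \<open>g (- a)\<close> is the conjugate of \<open>g a\<close>, this second moment
  counts pairs with equal \<open>k\<close>-th powers.\<close>

lemma sum_norm_g: "(\<Sum>a\<in>U. (norm (g a))\<^sup>2) = Q * (Q - 1) * m"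
proof -
  have "complex_of_real (\<Sum>a\<in>U. (norm (g a))\<^sup>2) = (\<Sum>a\<in>U. g a * g (- 1 * a))"
    by (simp only: of_real_sum complex_norm_square g_uminus mult_minus1)
  also have "\<dots> = of_real (Q * (1 + (Q - 1) * e) - Q\<^sup>2)"
    by (simp only: sum_g_mult_g card_equal_powers)
  finally have "(\<Sum>a\<in>U. (norm (g a))\<^sup>2) = Q * (1 + (Q - 1) * e) - Q\<^sup>2"
    by (simp only: of_real_eq_iff)
  then show ?thesis by (simp add: m_def algebra_simps power2_eq_square)
qed

lemma sum_norm_\<tau>: "(\<Sum>a\<in>U. (norm (\<tau> a))\<^sup>2) = (Q - 1) * (Q * m + 1)"
proof -
  have "(norm (\<tau> a))\<^sup>2 = (norm (g a))\<^sup>2 - 2 * Re (g a) + 1" for a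
    unfolding \<tau>_eq cmod_power2 by (simp add: power2_eq_square algebra_simps)
  then have "(\<Sum>a\<in>U. (norm (\<tau> a))\<^sup>2) = (\<Sum>a\<in>U. (norm (g a))\<^sup>2) - 2 * Re (\<Sum>a\<in>U. g a) + real (card U)"
    by (simp add: sum.distrib sum_subtractf sum_distrib_left)
  then show ?thesis unfolding sum_g sum_norm_g card_U by (simp add: algebra_simps)
qed

text \<open>The indicator of the coset of \<open>a\<close>, scaled by \<open>e\<close>: the
  multiplicity with which \<open>y \<mapsto> a * y ^ k\<close> hits \<open>b\<close>.\<close>

definition w :: "'a \<Rightarrow> 'a \<Rightarrow> real" where "w a b = real (card {y \<in> U. a * y ^ k = b})"

lemma sum_over_coset:
  fixes f :: "'a \<Rightarrow> 'b :: real_algebra_1"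
  assumes "a \<noteq> 0"
  shows "(\<Sum>y\<in>U. f (a * y ^ k)) = (\<Sum>b\<in>U. of_real (w a b) * f b)"
proof -
  have "(\<Sum>y\<in>U. f (a * y ^ k)) = (\<Sum>b\<in>U. \<Sum>y\<in>{y \<in> U. a * y ^ k = b}. f (a * y ^ k))"
    by (rule sum.group[symmetric]) (use assms in auto)
  also have "\<dots> = (\<Sum>b\<in>U. of_real (w a b) * f b)" by (intro sum.cong) (auto simp: w_def)
  finally show ?thesis .
qed

lemma w_on_coset:
  assumes "a \<noteq> 0" and "y \<noteq> 0"
  shows "w a (a * y ^ k) = e"
proof -
  have "{x \<in> U. a * x ^ k = a * y ^ k} = {x. x ^ k = y ^ k}" using assms by auto
  then show ?thesis using card_fibre assms by (simp add: w_def)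
qed

text \<open>Averaging \<open>g\<close> over the coset of \<open>a\<close> pairs \<open>g\<close> with \<open>w a\<close>; since \<open>g\<close> has sum zero, \<open>w a\<close> may be
  replaced by \<open>w a - 1\<close> before applying the Cauchy--Schwarz inequality. This gives \<open>m\<^sup>2\<close> instead of \<open>m (m + 1)\<close>.\<close>

lemma norm_g_le:
  assumes "a \<noteq> 0"
  shows "(norm (g a))\<^sup>2 \<le> Q * m\<^sup>2"
proof -
  have "complex_of_real (\<Sum>b\<in>U. w a b) = of_real (real (card U))" using sum_over_coset[OF assms, of "\<lambda>_. 1 :: complex"] by simp
  then have w1: "(\<Sum>b\<in>U. w a b) = Q - 1" unfolding card_U by (simp only: of_real_eq_iff)
  have "complex_of_real (\<Sum>b\<in>U. (w a b)\<^sup>2) = (\<Sum>y\<in>U. of_real (w a (a * y ^ k)))"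
    using sum_over_coset[OF assms, of "\<lambda>b. complex_of_real (w a b)"] by (simp add: power2_eq_square)
  also have "\<dots> = of_real (real (card U) * e)" using w_on_coset[OF assms] by simp
  finally have w2: "(\<Sum>b\<in>U. (w a b)\<^sup>2) = (Q - 1) * e" unfolding card_U by (simp only: of_real_eq_iff)
  have w3: "(\<Sum>b\<in>U. (w a b - 1)\<^sup>2) = (Q - 1) * m"
  proof -
    have "(\<Sum>b\<in>U. (w a b - 1)\<^sup>2) = (\<Sum>b\<in>U. (w a b)\<^sup>2) - 2 * (\<Sum>b\<in>U. w a b) + real (card U)"
      by (simp add: power2_diff sum.distrib sum_subtractf sum_distrib_left)
    then show ?thesis unfolding w1 w2 card_U m_def by (simp add: algebra_simps)
  qed
  have "of_real (Q - 1) * g a = (\<Sum>y\<in>U. g (a * y ^ k))"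
    unfolding card_U[symmetric] using g_twist by simp
  also have "\<dots> = (\<Sum>b\<in>U. of_real (w a b) * g b)" by (rule sum_over_coset[OF assms])
  also have "\<dots> = (\<Sum>b\<in>U. of_real (w a b - 1) * g b)"
    using sum_g by (simp add: left_diff_distrib sum_subtractf)
  finally have "(Q - 1) * norm (g a) = norm (\<Sum>b\<in>U. of_real (w a b - 1) * g b)"
    using Q_gt_1 by (metis abs_of_pos diff_gt_0_iff_gt norm_mult norm_of_real)
  also have "\<dots> \<le> (\<Sum>b\<in>U. \<bar>w a b - 1\<bar> * norm (g b))"
    by (rule order.trans[OF norm_sum]) (simp add: norm_mult del: of_real_diff)
  finally have "((Q - 1) * norm (g a))\<^sup>2 \<le> (\<Sum>b\<in>U. \<bar>w a b - 1\<bar> * norm (g b))\<^sup>2"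
    using Q_gt_1 by (intro power_mono) auto
  also have "\<dots> \<le> (\<Sum>b\<in>U. \<bar>w a b - 1\<bar>\<^sup>2) * (\<Sum>b\<in>U. (norm (g b))\<^sup>2)"
    by (rule Cauchy_Schwarz_ineq_sum)
  also have "\<dots> = (Q - 1)\<^sup>2 * (Q * m\<^sup>2)"
    by (simp only: power2_abs w3 sum_norm_g) (simp add: power2_eq_square algebra_simps)
  finally show ?thesis using Q_gt_1 by (simp add: power_mult_distrib)
qed

lemma norm_g_le':
  assumes "a \<noteq> 0"
  shows "norm (g a) \<le> m * sqrt Q"
proof (rule power2_le_imp_le)
  have "(m * sqrt Q)\<^sup>2 = Q * m\<^sup>2" by (simp add: power_mult_distrib)
  then show "(norm (g a))\<^sup>2 \<le> (m * sqrt Q)\<^sup>2" using norm_g_le[OF assms] by simp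
qed (use m_nonneg in auto)

end

section \<open>Sums of two and of four \<open>k\<close>-th powers\<close>

context kth_power_sums
begin

text \<open>The pointwise bound is spent on one factor only; the other two are summed exactly by the
  second moment.\<close>

lemma norm_sum_g_triple_le:
  assumes "c \<noteq> 0"
  shows "norm (\<Sum>a\<in>U. (g a)\<^sup>2 * g (c * a)) \<le> m * sqrt Q * (Q * (Q - 1) * m)"
proof -
  have "norm (\<Sum>a\<in>U. (g a)\<^sup>2 * g (c * a)) \<le> (\<Sum>a\<in>U. (m * sqrt Q) * (norm (g a))\<^sup>2)"
  proof (rule sum_norm_le)
    fix a assume "a \<in> U"
    then have "norm (g (c * a)) \<le> m * sqrt Q" using norm_g_le' assms by simp
    then show "norm ((g a)\<^sup>2 * g (c * a)) \<le> (m * sqrt Q) * (norm (g a))\<^sup>2"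
      by (simp add: norm_mult norm_power mult.commute[of "(norm (g a))\<^sup>2"] mult_right_mono del: Q_def)
  qed
  also have "\<dots> = m * sqrt Q * (Q * (Q - 1) * m)" by (simp only: sum_distrib_left[symmetric] sum_norm_g)
  finally show ?thesis .
qed

lemma card_trivial_solutions:
  fixes c :: 'a
  assumes "c \<noteq> 0" and "\<And>h. h \<noteq> 0 \<Longrightarrow> h ^ k \<noteq> - c"
  shows "card {w. fst w ^ k + c * snd w ^ k = 0} = 1"
proof -
  have "x = 0 \<and> y = 0" if xy: "x ^ k + c * y ^ k = 0" for x y
  proof (cases "y = 0")
    case False
    have "x ^ k = - c * y ^ k" using xy by (simp add: eq_neg_iff_add_eq_0)
    then have *: "(x / y) ^ k = - c" using False by (simp add: power_divide)
    then have "x / y \<noteq> 0" using assms(1) by (metis neg_equal_0_iff_equal zero_power_k)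
    then show ?thesis using assms(2) * by blast
  qed (use xy in auto)
  then have "w = (0, 0)" if "fst w ^ k + c * snd w ^ k = 0" for w
    using that by (metis prod.collapse)
  moreover have "fst (0, 0) ^ k + c * snd (0, 0) ^ k = 0" by simp
  ultimately have "{w. fst w ^ k + c * snd w ^ k = 0} = {(0, 0)}" by blast
  then show ?thesis by simp
qed

text \<open>All fibres of the power map on nonzero elements have size \<open>e\<close>. The
  divisibility serves to discard small field sizes in the numerical bounds.\<close>

lemma e_dvd: "e dvd CARD('a) - 1"
proof -
  have "CARD('a) - 1 = (\<Sum>y\<in>U. 1)" by (simp add: card_Diff_singleton)
  also have "\<dots> = (\<Sum>b\<in>(\<lambda>y. y ^ k) ` U. \<Sum>y\<in>{y \<in> U. y ^ k = b}. 1)"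
    by (rule sum.group[symmetric]) auto
  also have "\<dots> = (\<Sum>b\<in>(\<lambda>y. y ^ k) ` U. e)"
  proof (rule sum.cong)
    fix b assume "b \<in> (\<lambda>y. y ^ k) ` U"
    then obtain y where "y \<noteq> 0" "b = y ^ k" by blast
    moreover from this have "{x \<in> U. x ^ k = b} = {x. x ^ k = y ^ k}" by auto
    ultimately show "(\<Sum>y\<in>{y \<in> U. y ^ k = b}. 1) = e" using card_fibre[of y] by simp
  qed simp
  finally show ?thesis by simp
qed

lemma surj_power_if_e_eq_1:
  assumes "e = 1"
  shows "\<exists>x :: 'a. x ^ k = c"
proof -
  have "inj (\<lambda>x :: 'a. x ^ k)"
  proof (rule injI)
    fix x y :: 'a assume xy: "x ^ k = y ^ k"
    show "x = y"
    proof (cases "y = 0")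
      case False
      then have "card {z. z ^ k = y ^ k} = 1" using card_fibre assms by simp
      then obtain z where "{z. z ^ k = y ^ k} = {z}" by (auto simp: card_1_singleton_iff)
      then have "x = z" "y = z" using xy by blast+
      then show ?thesis by simp
    qed (use xy in simp)
  qed
  then have "surj (\<lambda>x :: 'a. x ^ k)" by (simp add: finite_UNIV_inj_surj)
  then show ?thesis by (metis surjD)
qed

text \<open>The number of solutions of \<open>x\<^sup>k + y\<^sup>k = c z\<^sup>k\<close> with \<open>z \<noteq> 0\<close> is expressed by sums of \<open>g\<close>. If \<open>-1\<close> is a \<open>k\<close>-th
  power, then \<open>g\<close> is real and the cubic sum is bounded from below by the positivity of
  \<open>\<Sum> (g a + \<alpha>)\<^sup>2 (g (- c a) + m \<surd>Q)\<close>; the choice \<open>\<alpha> = \<surd>Q / m\<close> is optimal.\<close>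

lemma sum_of_two_powers:
  assumes Qm: "Q > m ^ 4"
  shows "\<exists>x y :: 'a. x ^ k + y ^ k = c"
proof (rule ccontr)
  assume no: "\<not> ?thesis"
  have c0: "c \<noteq> 0" using no zero_power_k by (metis add.left_neutral)
  have cH: "h ^ k \<noteq> c" for h :: 'a using no zero_power_k by (metis add.left_neutral)
  \<comment> \<open>The power map misses \<open>c\<close>, so it is not bijective. The resulting
    \<open>m \<ge> 1\<close> permits the division by \<open>m\<close> in
    \<open>\<alpha>\<close>.\<close>
  have e2: "e \<ge> 2" using surj_power_if_e_eq_1[of c] cH e_pos by fastforce
  then have m1: "m \<ge> 1" by (simp add: m_def)
  define s where "s = sqrt Q"
  have s: "s > 0" "s\<^sup>2 = Q" using Q_gt_1 by (auto simp: s_def)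
  have sm: "s > m\<^sup>2"
  proof (rule power2_less_imp_less)
    show "(m\<^sup>2)\<^sup>2 < s\<^sup>2" using Qm s by (simp add: power_mult[symmetric])
  qed (use s in simp)
  \<comment> \<open>There are no solutions to count, so the terms with nonzero \<open>a\<close> must
    cancel the term of \<open>a = 0\<close>, which is \<open>Q^2 * (Q - 1)\<close>.\<close>
  have "(\<Sum>a\<in>UNIV. g a * (g a * \<tau> (- c * a))) =
      (\<Sum>a\<in>UNIV. \<Sum>w\<in>UNIV \<times> UNIV \<times> U. \<psi> (a * (fst w ^ k + (fst (snd w) ^ k + - c * snd (snd w) ^ k))))"
  proof (rule sum.cong)
    fix a
    have *: "\<tau> (- c * a) = (\<Sum>x\<in>U. \<psi> (a * (- c * x ^ k)))" by (simp add: \<tau>_def ac_simps)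
    show "g a * (g a * \<tau> (- c * a)) =
      (\<Sum>w\<in>UNIV \<times> UNIV \<times> U. \<psi> (a * (fst w ^ k + (fst (snd w) ^ k + - c * snd (snd w) ^ k))))"
      unfolding * g_def psi_sum_mult ..
  qed simp
  also have "\<dots> = of_real (Q * real (card {w \<in> UNIV \<times> UNIV \<times> U. fst w ^ k + (fst (snd w) ^ k + - c * snd (snd w) ^ k) = 0}))"
    by (rule card_solutions) simp
  also have "{w \<in> UNIV \<times> UNIV \<times> U. fst w ^ k + (fst (snd w) ^ k + - c * snd (snd w) ^ k) = 0} = {}"
  proof -
    have False if "z \<noteq> 0" "x ^ k + (y ^ k + - c * z ^ k) = 0" for x y z
    proof -
      have "(x / z) ^ k + (y / z) ^ k = c" using that
        by (simp add: power_divide add_divide_distrib[symmetric] divide_eq_eq algebra_simps)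
      then show False using no by blast
    qed
    then show ?thesis by fastforce
  qed
  finally have "(\<Sum>a\<in>UNIV. g a * (g a * \<tau> (- c * a))) = 0" by simp
  then have "of_real (Q\<^sup>2 * (Q - 1)) + (\<Sum>a\<in>U. (g a)\<^sup>2 * g (- c * a) - (g a)\<^sup>2) = 0"
    unfolding sum_UNIV_eq by (simp add: g_0 \<tau>_eq power2_eq_square algebra_simps)
  then have cubic: "(\<Sum>a\<in>U. (g a)\<^sup>2 * g (- c * a)) = (\<Sum>a\<in>U. (g a)\<^sup>2) - of_real (Q\<^sup>2 * (Q - 1))"
    unfolding sum_subtractf by (simp add: algebra_simps)
  show False
  proof (cases "\<exists>h :: 'a. h \<noteq> 0 \<and> h ^ k = - 1")
    \<comment> \<open>Now \<open>x ^ k + y ^ k = 0\<close> has only the trivial solution, which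
      gives the cubic sum the modulus \<open>Q * (Q - 1) * (Q + 1)\<close>, too large for
      \<open>norm_sum_g_triple_le\<close>.\<close>
    case False
    then have "(\<Sum>a\<in>U. (g a)\<^sup>2) = of_real (Q - Q\<^sup>2)"
      using sum_g_mult_g[of 1] card_trivial_solutions[of 1]
      by (auto simp: power2_eq_square)
    then have "(\<Sum>a\<in>U. (g a)\<^sup>2 * g (- c * a)) = of_real (- (Q * (Q - 1) * (Q + 1)))"
      unfolding cubic by (simp add: power2_eq_square algebra_simps)
    then have "norm (\<Sum>a\<in>U. (g a)\<^sup>2 * g (- c * a)) = Q * (Q - 1) * (Q + 1)"
      using Q_gt_1 by (simp only: norm_of_real) simp
    then have "Q * (Q - 1) * (Q + 1) \<le> Q * (Q - 1) * (m\<^sup>2 * s)"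
      using norm_sum_g_triple_le[of "- c"] c0 by (simp add: s_def power2_eq_square algebra_simps)
    then have "Q + 1 \<le> m\<^sup>2 * s" using Q_gt_1 by (simp del: Q_def)
    moreover have "m\<^sup>2 * s \<le> s * s" using sm s by (intro mult_right_mono) auto
    ultimately show False using s(2) power2_eq_square[of s] by linarith
  next
    case True
    then obtain h :: 'a where h: "h \<noteq> 0" "h ^ k = - 1" by blast
    have "g (- a) = g a" for a using g_twist[OF h(1), of a] h(2) by simp
    then have real: "Im (g a) = 0" for a using g_uminus[of a] by (metis Reals_cnj_iff complex_is_Real_iff)
    define r where "r a = Re (g a)" for a
    have gr: "g a = of_real (r a)" for a using real[of a] by (simp add: complex_eq_iff r_def)
    define r' where "r' a = r (- c * a)" for a
    have r1: "(\<Sum>a\<in>U. r a) = 0"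
      using sum_g unfolding gr by (metis of_real_eq_0_iff of_real_sum)
    have r1': "(\<Sum>a\<in>U. r' a) = 0" using sum_U_scale[of "- c" r] c0 r1 by (simp add: r'_def)
    have r2: "(\<Sum>a\<in>U. (r a)\<^sup>2) = Q * (Q - 1) * m" using sum_norm_g unfolding gr by (simp only: norm_of_real power2_abs)
    \<comment> \<open>The correlation counts solutions of \<open>x ^ k = c * y ^ k\<close>; only the
      trivial one exists because \<open>c\<close> is not a power.\<close>
    have "complex_of_real (\<Sum>a\<in>U. r a * r' a) = of_real (Q - Q\<^sup>2)"
      using sum_g_mult_g[of "- c"] card_trivial_solutions[of "- c"] cH c0
      unfolding gr r'_def by simp
    then have r11: "(\<Sum>a\<in>U. r a * r' a) = Q - Q\<^sup>2" by (simp only: of_real_eq_iff)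
    have "complex_of_real (\<Sum>a\<in>U. (r a)\<^sup>2 * r' a) = of_real ((\<Sum>a\<in>U. (r a)\<^sup>2) - Q\<^sup>2 * (Q - 1))"
      using cubic unfolding gr r'_def by simp
    then have r21: "(\<Sum>a\<in>U. (r a)\<^sup>2 * r' a) = Q * (Q - 1) * m - Q\<^sup>2 * (Q - 1)" unfolding r2 by (simp only: of_real_eq_iff)
    define M where "M = m * s"
    define \<alpha> where "\<alpha> = s / m"
    have "r' a + M \<ge> 0" if "a \<in> U" for a
    proof -
      have "norm (g (- c * a)) \<le> M" using norm_g_le'[of "- c * a"] that c0 by (simp add: M_def s_def)
      then show ?thesis unfolding gr r'_def by (simp only: norm_of_real)
    qed
    then have "0 \<le> (\<Sum>a\<in>U. (r a + \<alpha>)\<^sup>2 * (r' a + M))" by (intro sum_nonneg) simp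
    also have "\<dots> = (\<Sum>a\<in>U. (r a)\<^sup>2 * r' a + 2 * \<alpha> * (r a * r' a) + \<alpha>\<^sup>2 * r' a + M * (r a)\<^sup>2 + 2 * \<alpha> * M * r a + \<alpha>\<^sup>2 * M)"
      by (intro sum.cong) (auto simp: power2_eq_square algebra_simps)
    also have "\<dots> = Q * (Q - 1) * m - Q\<^sup>2 * (Q - 1) + 2 * \<alpha> * (Q - Q\<^sup>2) + M * (Q * (Q - 1) * m) + \<alpha>\<^sup>2 * M * (Q - 1)"
      unfolding sum.distrib sum_distrib_left[symmetric] r1 r1' r2 r11 r21 sum_constant card_U by simp
    also have "\<dots> = (Q - 1) * (Q * m - Q\<^sup>2 - 2 * \<alpha> * Q + M * Q * m + \<alpha>\<^sup>2 * M)"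
      by (simp add: power2_eq_square algebra_simps del: Q_def)
    finally have "0 \<le> Q * m - Q\<^sup>2 - 2 * \<alpha> * Q + M * Q * m + \<alpha>\<^sup>2 * M"
      using Q_gt_1 by (simp add: zero_le_mult_iff del: Q_def)
    \<comment> \<open>For this \<open>\<alpha>\<close> the expression changes sign at
      \<open>s = m^2\<close>; this is the origin of the hypothesis \<open>Q > m ^ 4\<close>.\<close>
    also have "\<dots> = s\<^sup>2 * (- ((s - m\<^sup>2) * (s + 1 / m)))"
      unfolding s(2)[symmetric] M_def \<alpha>_def using m1 by (simp add: field_simps power2_eq_square)
    finally have "(s - m\<^sup>2) * (s + 1 / m) \<le> 0" using s by (simp add: mult_le_0_iff)
    moreover have "(s - m\<^sup>2) * (s + 1 / m) > 0" using sm s m1 by (intro mult_pos_pos) (auto intro: add_pos_pos)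
    ultimately show False by simp
  qed
qed

end

section \<open>Four nonzero \<open>k\<close>-th powers: moments of \<open>\<tau>\<close>\<close>

context kth_power_sums
begin

lemma norm_\<tau>_le: "a \<noteq> 0 \<Longrightarrow> norm (\<tau> a) \<le> m * sqrt Q + 1"
  unfolding \<tau>_eq using norm_g_le'[of a] norm_triangle_ineq4[of "g a" 1] by simp

lemma \<tau>_twist: "h \<noteq> 0 \<Longrightarrow> \<tau> (a * h ^ k) = \<tau> a"
  by (simp add: \<tau>_eq g_twist)

lemma norm_\<tau>_uminus: "norm (\<tau> (- a)) = norm (\<tau> a)"
proof -
  have "\<tau> (- a) = cnj (\<tau> a)" by (simp add: \<tau>_eq g_uminus)
  then show ?thesis by simp
qed

text \<open>The equation is homogenised to \<open>x^k + y^k + z^k + w^k = t * v^k\<close> with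
  \<open>v\<close> nonzero. The extra factor \<open>\<tau> (- t * a)\<close> is paired with one
  \<open>\<tau> a\<close> by \<open>2 u v \<le> u^2 + v^2\<close>, so both enter through the second
  moment and three factors through the pointwise bound. Up to lower order terms the condition
  becomes \<open>m^4 < Q^(3/2)\<close>, instead of \<open>m^3 < Q\<close> without
  \<open>v\<close>.\<close>

lemma sum_of_four_nonzero_powers_nonzero:
  assumes t: "t \<noteq> 0" and num: "(Q - 1) ^ 4 > (Q * m + 1) * (m * sqrt Q + 1) ^ 3"
  shows "\<exists>x y z w :: 'a. x \<noteq> 0 \<and> y \<noteq> 0 \<and> z \<noteq> 0 \<and> w \<noteq> 0 \<and> x ^ k + y ^ k + (z ^ k + w ^ k) = t"
proof (rule ccontr)
  assume no: "\<not> ?thesis"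
  define B where "B = m * sqrt Q + 1"
  have B0: "B \<ge> 0" using m_nonneg by (simp add: B_def)
  have "(\<Sum>a\<in>UNIV. ((\<tau> a * \<tau> a) * (\<tau> a * \<tau> a)) * \<tau> (- t * a)) =
      (\<Sum>a\<in>UNIV. \<Sum>w\<in>((U \<times> U) \<times> (U \<times> U)) \<times> U. \<psi> (a * (fst (fst (fst w)) ^ k + snd (fst (fst w)) ^ k
        + (fst (snd (fst w)) ^ k + snd (snd (fst w)) ^ k) + - t * snd w ^ k)))"
  proof (rule sum.cong)
    fix a
    have *: "\<tau> (- t * a) = (\<Sum>x\<in>U. \<psi> (a * (- t * x ^ k)))" by (simp add: \<tau>_def ac_simps)
    show "((\<tau> a * \<tau> a) * (\<tau> a * \<tau> a)) * \<tau> (- t * a) =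
      (\<Sum>w\<in>((U \<times> U) \<times> (U \<times> U)) \<times> U. \<psi> (a * (fst (fst (fst w)) ^ k + snd (fst (fst w)) ^ k
        + (fst (snd (fst w)) ^ k + snd (snd (fst w)) ^ k) + - t * snd w ^ k)))"
      by (subst *) (simp only: \<tau>_def psi_sum_mult)
  qed simp
  also have "\<dots> = of_real (Q * real (card {w \<in> ((U \<times> U) \<times> (U \<times> U)) \<times> U.
      fst (fst (fst w)) ^ k + snd (fst (fst w)) ^ k
        + (fst (snd (fst w)) ^ k + snd (snd (fst w)) ^ k) + - t * snd w ^ k = 0}))"
    by (rule card_solutions) simp
  also have "{w \<in> ((U \<times> U) \<times> (U \<times> U)) \<times> U. fst (fst (fst w)) ^ k + snd (fst (fst w)) ^ k
        + (fst (snd (fst w)) ^ k + snd (snd (fst w)) ^ k) + - t * snd w ^ k = 0} = {}"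
  proof -
    have F: False if nz: "x \<noteq> 0" "y \<noteq> 0" "z \<noteq> 0" "w \<noteq> 0" "v \<noteq> 0"
      and eq: "x ^ k + y ^ k + (z ^ k + w ^ k) + - t * v ^ k = 0" for x y z w v
    proof -
      have "(x / v) ^ k + (y / v) ^ k + ((z / v) ^ k + (w / v) ^ k) = (x ^ k + y ^ k + (z ^ k + w ^ k)) / v ^ k"
        by (simp add: power_divide add_divide_distrib)
      also have "x ^ k + y ^ k + (z ^ k + w ^ k) = t * v ^ k" using eq by (simp add: add_eq_0_iff2)
      also have "t * v ^ k / v ^ k = t" using nz by simp
      finally show False using no nz by (metis divide_eq_0_iff)
    qed
    have False if "w \<in> ((U \<times> U) \<times> (U \<times> U)) \<times> U" and "fst (fst (fst w)) ^ k + snd (fst (fst w)) ^ k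
        + (fst (snd (fst w)) ^ k + snd (snd (fst w)) ^ k) + - t * snd w ^ k = 0" for w
      by (rule F[OF _ _ _ _ _ that(2)]) (use that(1) in \<open>simp_all add: mem_Times_iff\<close>)
    then show ?thesis by blast
  qed
  finally have zero: "(\<Sum>a\<in>UNIV. ((\<tau> a * \<tau> a) * (\<tau> a * \<tau> a)) * \<tau> (- t * a)) = 0" by simp
  have z: "((\<tau> 0 * \<tau> 0) * (\<tau> 0 * \<tau> 0)) * \<tau> (- t * 0) = of_real ((Q - 1) ^ 5)"
    unfolding mult_zero_right \<tau>_0 of_real_mult[symmetric]
    by (simp add: eval_nat_numeral del: Q_def of_real_mult of_real_power of_real_diff)
  have "(\<Sum>a\<in>U. ((\<tau> a * \<tau> a) * (\<tau> a * \<tau> a)) * \<tau> (- t * a)) = of_real (- ((Q - 1) ^ 5))"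
    using zero unfolding sum_UNIV_eq z of_real_minus by (simp only: add.commute eq_neg_iff_add_eq_0)
  then have "(Q - 1) ^ 5 = norm (\<Sum>a\<in>U. ((\<tau> a * \<tau> a) * (\<tau> a * \<tau> a)) * \<tau> (- t * a))"
    using Q_gt_1 by (simp only: norm_of_real) simp
  also have "\<dots> \<le> (\<Sum>a\<in>U. B ^ 3 * (((norm (\<tau> a))\<^sup>2 + (norm (\<tau> (- t * a)))\<^sup>2) / 2))"
  proof (rule sum_norm_le)
    fix a assume "a \<in> U"
    then have "norm (\<tau> a) \<le> B" using norm_\<tau>_le by (simp add: B_def)
    then have "norm (\<tau> a) ^ 3 \<le> B ^ 3" by (intro power_mono) auto
    moreover have "norm (\<tau> a) * norm (\<tau> (- t * a)) \<le> ((norm (\<tau> a))\<^sup>2 + (norm (\<tau> (- t * a)))\<^sup>2) / 2"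
      using sum_squares_bound[of "norm (\<tau> a)" "norm (\<tau> (- t * a))"] by simp
    ultimately have "norm (\<tau> a) ^ 3 * (norm (\<tau> a) * norm (\<tau> (- t * a)))
        \<le> B ^ 3 * (((norm (\<tau> a))\<^sup>2 + (norm (\<tau> (- t * a)))\<^sup>2) / 2)"
      using B0 by (intro mult_mono) auto
    then show "norm (((\<tau> a * \<tau> a) * (\<tau> a * \<tau> a)) * \<tau> (- t * a)) \<le> B ^ 3 * (((norm (\<tau> a))\<^sup>2 + (norm (\<tau> (- t * a)))\<^sup>2) / 2)"
      by (simp only: norm_mult power3_eq_cube ac_simps)
  qed
  also have "\<dots> = B ^ 3 * (((\<Sum>a\<in>U. (norm (\<tau> a))\<^sup>2) + (\<Sum>a\<in>U. (norm (\<tau> (- t * a)))\<^sup>2)) / 2)"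
    by (simp only: sum_distrib_left[symmetric] sum_divide_distrib[symmetric] sum.distrib)
  also have "(\<Sum>a\<in>U. (norm (\<tau> (- t * a)))\<^sup>2) = (\<Sum>a\<in>U. (norm (\<tau> a))\<^sup>2)"
    by (rule sum_U_scale) (use t in simp)
  also have "B ^ 3 * (((\<Sum>a\<in>U. (norm (\<tau> a))\<^sup>2) + (\<Sum>a\<in>U. (norm (\<tau> a))\<^sup>2)) / 2) = (Q - 1) * ((Q * m + 1) * B ^ 3)"
    by (simp only: sum_norm_\<tau>) simp
  finally have "(Q - 1) * (Q - 1) ^ 4 \<le> (Q - 1) * ((Q * m + 1) * B ^ 3)"
    by (simp add: eval_nat_numeral del: Q_def)
  then show False using num Q_gt_1 unfolding B_def by (simp del: Q_def)
qed

text \<open>If \<open>-1\<close> is not a \<open>k\<close>-th power, the cosets of \<open>a\<close> and \<open>-a\<close> are disjoint and \<open>\<bar>\<tau>\<bar>\<close> agrees on them, so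
  that each value of \<open>\<bar>\<tau>\<bar>\<close> is taken twice as often.\<close>

lemma norm_\<tau>_le_half:
  assumes a: "a \<noteq> 0" and neg: "\<And>h. h ^ k \<noteq> (- 1 :: 'a)"
  shows "(norm (\<tau> a))\<^sup>2 \<le> e * (Q * m + 1) / 2"
proof -
  have coset: "(\<Sum>b\<in>U. w c b * (norm (\<tau> b))\<^sup>2) = (Q - 1) * (norm (\<tau> a))\<^sup>2"
    if "c = a \<or> c = - a" for c
  proof -
    have "(\<Sum>b\<in>U. w c b * (norm (\<tau> b))\<^sup>2) = (\<Sum>y\<in>U. (norm (\<tau> (c * y ^ k)))\<^sup>2)"
      using sum_over_coset[of c "\<lambda>b. (norm (\<tau> b))\<^sup>2"] that a by auto
    also have "\<dots> = (\<Sum>y\<in>U. (norm (\<tau> a))\<^sup>2)"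
      using that by (intro sum.cong) (auto simp: \<tau>_twist norm_\<tau>_uminus[of a] simp del: mult_minus_left)
    finally show ?thesis using card_U by simp
  qed
  have "w a b + w (- a) b \<le> e" if "b \<in> U" for b
  proof (cases "\<exists>y\<in>U. b = a * y ^ k")
    case True
    then obtain y where y: "y \<noteq> 0" "b = a * y ^ k" by blast
    have "{z \<in> U. - a * z ^ k = b} = {}"
    proof -
      have False if z: "z \<noteq> 0" "- a * z ^ k = a * y ^ k" for z
      proof -
        have "a * y ^ k = a * (- (z ^ k))" using z(2) by simp
        then have "y ^ k = - (z ^ k)" using a by (metis mult_left_cancel)
        then have "(y / z) ^ k = - 1" using z by (simp add: power_divide)
        then show False using neg by blast
      qed
      then show ?thesis using y by auto
    qed
    then show ?thesis using y w_on_coset[OF a y(1)] by (simp add: w_def)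
  next
    case False
    then have wa: "w a b = 0" by (auto simp: w_def)
    show ?thesis
    proof (cases "\<exists>y\<in>U. b = - a * y ^ k")
      case True
      then obtain y where "y \<noteq> 0" "b = - a * y ^ k" by blast
      then show ?thesis using w_on_coset[of "- a" y] a wa by simp
    next
      case False
      then have "w (- a) b = 0" by (auto simp: w_def)
      then show ?thesis using wa by simp
    qed
  qed
  then have "(\<Sum>b\<in>U. (w a b + w (- a) b) * (norm (\<tau> b))\<^sup>2) \<le> (\<Sum>b\<in>U. e * (norm (\<tau> b))\<^sup>2)"
    by (intro sum_mono mult_right_mono) auto
  also have "\<dots> = e * ((Q - 1) * (Q * m + 1))" by (simp only: sum_distrib_left[symmetric] sum_norm_\<tau>)
  also have "(\<Sum>b\<in>U. (w a b + w (- a) b) * (norm (\<tau> b))\<^sup>2) = (Q - 1) * (2 * (norm (\<tau> a))\<^sup>2)"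
    using coset by (simp add: distrib_right sum.distrib del: Q_def)
  finally have "(Q - 1) * (2 * (norm (\<tau> a))\<^sup>2) \<le> (Q - 1) * (e * (Q * m + 1))" by (simp only: ac_simps)
  then have "2 * (norm (\<tau> a))\<^sup>2 \<le> e * (Q * m + 1)" using Q_gt_1 by (simp del: Q_def)
  then show ?thesis by simp
qed

text \<open>If \<open>-1\<close> is a power, two cancelling pairs do. Otherwise the fourth moment is
  estimated; for the target zero a factor \<open>v^k\<close> would bring no oscillation, and the
  saving comes from the halved bound \<open>norm_\<tau>_le_half\<close>, leaving roughly
  \<open>e * m^2 < 2 * Q\<close>.\<close>

lemma sum_of_four_nonzero_powers_zero:
  assumes num: "2 * (Q - 1) ^ 3 > e * (Q * m + 1)\<^sup>2"
  shows "\<exists>x y z w :: 'a. x \<noteq> 0 \<and> y \<noteq> 0 \<and> z \<noteq> 0 \<and> w \<noteq> 0 \<and> x ^ k + y ^ k + (z ^ k + w ^ k) = 0"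
proof (cases "\<exists>h::'a. h ^ k = - 1")
  case True
  then obtain h :: 'a where h: "h ^ k = - 1" by blast
  then have "h \<noteq> 0" by auto
  then show ?thesis using h by (intro exI[of _ 1] exI[of _ h]) auto
next
  case False
  show ?thesis
  proof (rule ccontr)
    assume no: "\<not> ?thesis"
    define B where "B = e * (Q * m + 1) / 2"
    have "(\<Sum>a\<in>UNIV. (\<tau> a * \<tau> a) * (\<tau> a * \<tau> a)) =
        (\<Sum>a\<in>UNIV. \<Sum>w\<in>(U \<times> U) \<times> (U \<times> U). \<psi> (a * (fst (fst w) ^ k + snd (fst w) ^ k
          + (fst (snd w) ^ k + snd (snd w) ^ k))))"
      unfolding \<tau>_def psi_sum_mult ..
    also have "\<dots> = of_real (Q * real (card {w \<in> (U \<times> U) \<times> (U \<times> U). fst (fst w) ^ k + snd (fst w) ^ k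
          + (fst (snd w) ^ k + snd (snd w) ^ k) = 0}))"
      by (rule card_solutions) simp
    also have "{w \<in> (U \<times> U) \<times> (U \<times> U). fst (fst w) ^ k + snd (fst w) ^ k
          + (fst (snd w) ^ k + snd (snd w) ^ k) = 0} = {}"
    proof -
      have False if "w \<in> (U \<times> U) \<times> (U \<times> U)" and eq: "fst (fst w) ^ k + snd (fst w) ^ k
          + (fst (snd w) ^ k + snd (snd w) ^ k) = 0" for w
      proof -
        have "fst (fst w) \<noteq> 0" "snd (fst w) \<noteq> 0" "fst (snd w) \<noteq> 0" "snd (snd w) \<noteq> 0"
          using that(1) by (simp_all add: mem_Times_iff)
        then show False using no eq by blast
      qed
      then show ?thesis by blast
    qed
    finally have zero: "(\<Sum>a\<in>UNIV. (\<tau> a * \<tau> a) * (\<tau> a * \<tau> a)) = 0" by simp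
    have z: "(\<tau> 0 * \<tau> 0) * (\<tau> 0 * \<tau> 0) = of_real ((Q - 1) ^ 4)"
      unfolding mult_zero_right \<tau>_0 of_real_mult[symmetric]
    by (simp add: eval_nat_numeral del: Q_def of_real_mult of_real_power of_real_diff)
    have "(\<Sum>a\<in>U. (\<tau> a * \<tau> a) * (\<tau> a * \<tau> a)) = of_real (- ((Q - 1) ^ 4))"
      using zero unfolding sum_UNIV_eq z of_real_minus by (simp only: add.commute eq_neg_iff_add_eq_0)
    then have "(Q - 1) ^ 4 = norm (\<Sum>a\<in>U. (\<tau> a * \<tau> a) * (\<tau> a * \<tau> a))"
      using Q_gt_1 by (simp only: norm_of_real) simp
    also have "\<dots> \<le> (\<Sum>a\<in>U. B * (norm (\<tau> a))\<^sup>2)"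
    proof (rule sum_norm_le)
      fix a assume "a \<in> U"
      then have "(norm (\<tau> a))\<^sup>2 \<le> B" using norm_\<tau>_le_half False unfolding B_def by auto
      then have "(norm (\<tau> a))\<^sup>2 * (norm (\<tau> a))\<^sup>2 \<le> B * (norm (\<tau> a))\<^sup>2" by (intro mult_right_mono) auto
      then show "norm ((\<tau> a * \<tau> a) * (\<tau> a * \<tau> a)) \<le> B * (norm (\<tau> a))\<^sup>2"
        by (simp only: norm_mult power2_eq_square)
    qed
    also have "\<dots> = (Q - 1) * (e * (Q * m + 1)\<^sup>2 / 2)"
      unfolding sum_distrib_left[symmetric] sum_norm_\<tau> B_def by (simp add: power2_eq_square)
    finally have "(Q - 1) * (Q - 1) ^ 3 \<le> (Q - 1) * (e * (Q * m + 1)\<^sup>2 / 2)"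
      by (simp add: eval_nat_numeral del: Q_def)
    then show False using num Q_gt_1 by (simp del: Q_def)
  qed
qed

end

section \<open>Numerical verification of the two moment conditions\<close>

lemma four_powers_bounds_large:
  fixes q m s :: real
  assumes m: "m \<ge> 3" and q: "q \<ge> m ^ 3 + 1" and s: "s \<ge> 0" "s\<^sup>2 = q"
  shows "(q * m + 1) * (m * s + 1) ^ 3 < (q - 1) ^ 4"
    and "(m + 1) * (q * m + 1)\<^sup>2 < 2 * (q - 1) ^ 3"
proof -
  \<comment> \<open>From \<open>m \<ge> 3\<close> follow \<open>r \<ge> 27\<close> and
    \<open>q * m \<ge> 84\<close>; hence the factors \<open>28 / 27\<close> and
    \<open>85 / 84\<close>, which absorb the shifts by one.\<close>
  define r where "r = q - 1"
  have m3: "m ^ 3 \<ge> 27" using power_mono[of 3 m 3] m by simp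
  then have r: "r \<ge> m ^ 3" "r \<ge> 27" using q by (auto simp: r_def)
  have q28: "q \<ge> 28" using r by (simp add: r_def)
  have qr: "q \<le> 28 / 27 * r" using r by (simp add: r_def)
  have qm: "q * m \<ge> 84" using mult_mono[of 28 q 3 m] q28 m by simp
  then have qm1: "q * m + 1 \<le> 85 / 84 * (q * m)" by linarith
  have "s \<ge> 5"
    by (rule power2_le_imp_le) (use s q28 in auto)
  then have "5 * s \<le> s * s" by (intro mult_right_mono) auto
  then have sq: "s \<le> q / 5" using s by (simp add: power2_eq_square)
  have mmq: "3 * (m * q) \<le> m\<^sup>2 * q" using mult_right_mono[of 3 m "m * q"] m q28 by (simp add: power2_eq_square mult.assoc)
  have "m * s \<le> m * (q / 5)" using sq m by (intro mult_left_mono) auto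
  then have "(m * s + 1)\<^sup>2 \<le> 114 / 100 * (m\<^sup>2 * q)"
  proof -
    have "(m * s + 1)\<^sup>2 = m\<^sup>2 * q + 2 * (m * s) + 1" by (simp add: power2_sum power_mult_distrib s)
    then show ?thesis using \<open>m * s \<le> m * (q / 5)\<close> mmq qm mult.commute[of q m] by linarith
  qed
  \<comment> \<open>Squaring removes \<open>s\<close>: up to constants the claim is
    \<open>m^8 * r^5 < r^8\<close>. Since \<open>r \<ge> m^3\<close>, a factor
    \<open>m \<ge> 3\<close> is left over against constants below \<open>2\<close>.\<close>
  then have "((m * s + 1)\<^sup>2) ^ 3 \<le> (114 / 100 * (m\<^sup>2 * q)) ^ 3" by (rule power_mono) simp
  moreover have "(q * m + 1)\<^sup>2 \<le> (85 / 84 * (q * m))\<^sup>2" using qm1 qm by (intro power_mono) auto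
  ultimately have "(q * m + 1)\<^sup>2 * ((m * s + 1)\<^sup>2) ^ 3 \<le> (85 / 84 * (q * m))\<^sup>2 * (114 / 100 * (m\<^sup>2 * q)) ^ 3"
    by (intro mult_mono) auto
  also have "\<dots> = (85 / 84)\<^sup>2 * (114 / 100) ^ 3 * m ^ 8 * q ^ 5"
    by (simp add: power_mult_distrib power_mult[symmetric] power_add[symmetric] eval_nat_numeral)
  also have "\<dots> \<le> (85 / 84)\<^sup>2 * (114 / 100) ^ 3 * m ^ 8 * (28 / 27 * r) ^ 5"
    using qr q28 by (intro mult_left_mono power_mono) auto
  also have "\<dots> = (85 / 84)\<^sup>2 * (114 / 100) ^ 3 * (28 / 27) ^ 5 * m ^ 8 * r ^ 5"
    by (simp only: power_mult_distrib ac_simps)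
  also have "\<dots> \<le> 2 * m ^ 8 * r ^ 5"
    using m r by (intro mult_right_mono) (auto simp: eval_nat_numeral divide_simps)
  also have "\<dots> < 3 * m ^ 8 * r ^ 5" using m r by simp
  also have "\<dots> \<le> m * m ^ 8 * r ^ 5" using m r by (intro mult_right_mono) auto
  also have "\<dots> = (m ^ 3) ^ 3 * r ^ 5" by (simp add: eval_nat_numeral)
  also have "\<dots> \<le> r ^ 3 * r ^ 5" using r m by (intro mult_right_mono power_mono) auto
  also have "\<dots> = (r ^ 4)\<^sup>2" by (simp add: power_add[symmetric] power_mult[symmetric])
  finally have "((q * m + 1) * (m * s + 1) ^ 3)\<^sup>2 < (r ^ 4)\<^sup>2"
    by (simp only: power_mult_distrib power_mult[symmetric] mult.commute)
  then show "(q * m + 1) * (m * s + 1) ^ 3 < (q - 1) ^ 4"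
    unfolding r_def by (rule power2_less_imp_less) simp
  have "(m + 1) * (q * m + 1)\<^sup>2 \<le> (4 / 3 * m) * (85 / 84 * (q * m))\<^sup>2"
    using m qm qm1 by (intro mult_mono power_mono) (simp_all add: add_nonneg_nonneg mult.commute)
  also have "\<dots> = 4 / 3 * (85 / 84)\<^sup>2 * m ^ 3 * q\<^sup>2" by (simp add: eval_nat_numeral)
  also have "\<dots> \<le> 4 / 3 * (85 / 84)\<^sup>2 * r * (28 / 27 * r)\<^sup>2"
    using m qr q28 r by (intro mult_mono power_mono) auto
  also have "\<dots> = (4 / 3 * (85 / 84)\<^sup>2 * (28 / 27)\<^sup>2) * r ^ 3" by (simp add: eval_nat_numeral)
  also have "\<dots> < 2 * r ^ 3" using r by (intro mult_strict_right_mono) (auto simp: eval_nat_numeral)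
  finally show "(m + 1) * (q * m + 1)\<^sup>2 < 2 * (q - 1) ^ 3" by (simp add: r_def)
qed

text \<open>For \<open>e = 1, 2, 3\<close> the term \<open>6 * e\<close> and the divisibility leave
  only \<open>q \<ge> 3\<close>, \<open>q \<ge> 5\<close> and \<open>q \<ge> 13\<close>. The size
  \<open>10\<close> has to be excluded by hand: for \<open>e = 3\<close> it meets the other
  hypotheses, but violates the first inequality.\<close>

lemma four_powers_bounds:
  fixes q e :: nat
  assumes e: "e \<ge> 1" and dvd: "e dvd q - 1" and q10: "q \<noteq> 10"
    and m: "m = real e - 1" and qm: "m ^ 6 + 6 * real e \<le> (real q)\<^sup>2"
  shows "(real q * m + 1) * (m * sqrt q + 1) ^ 3 < (real q - 1) ^ 4"
    and "real e * (real q * m + 1)\<^sup>2 < 2 * (real q - 1) ^ 3"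
proof -
  define s where "s = sqrt (real q)"
  have s: "s \<ge> 0" "s\<^sup>2 = q" by (auto simp: s_def)
  have sq: "s \<le> q / c" if "c > 0" "c\<^sup>2 \<le> q" for c :: real
  proof -
    have "c \<le> s" by (rule power2_le_imp_le) (use s that in auto)
    then have "c * s \<le> s * s" using s by (intro mult_right_mono) auto
    then show ?thesis using s that by (simp add: power2_eq_square field_simps)
  qed
  have cube: "(m * s + 1) ^ 3 = m ^ 3 * (q * s) + 3 * m\<^sup>2 * q + 3 * m * s + 1"
    unfolding s(2)[symmetric] by (simp add: eval_nat_numeral algebra_simps)
  consider "e = 1" | "e = 2" | "e = 3" | "e \<ge> 4" using e by linarith
  then have "(real q * m + 1) * (m * s + 1) ^ 3 < (real q - 1) ^ 4 \<and> real e * (real q * m + 1)\<^sup>2 < 2 * (real q - 1) ^ 3"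
  proof cases
    case 1
    have "q \<ge> 3"
    proof (rule ccontr)
      assume "\<not> q \<ge> 3"
      then have "(real q)\<^sup>2 \<le> 2\<^sup>2" by (intro power_mono) auto
      then show False using qm 1 m by simp
    qed
    then have "real q - 1 \<ge> 2" by simp
    then have "(real q - 1) ^ 4 \<ge> 2 ^ 4" "(real q - 1) ^ 3 \<ge> 2 ^ 3" by (rule power_mono; simp)+
    then show ?thesis using 1 m by simp
  next
    case 2
    have "q \<ge> 5"
    proof (rule ccontr)
      assume "\<not> q \<ge> 5"
      then have "q = 0 \<or> q = 1 \<or> q = 2 \<or> q = 3 \<or> q = 4" by arith
      then show False using qm 2 m dvd by auto
    qed
    then obtain t :: real where t: "t \<ge> 0" "real q = 5 + t" using that[of "real q - 5"] by simp
    \<comment> \<open>\<open>11 / 5\<close> is a rational lower bound for \<open>sqrt 5\<close>.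
      Expanded in \<open>t = q - 5\<close>, both differences below have nonnegative coefficients and
      a positive constant term; the case \<open>e = 3\<close> is alike with \<open>18 / 5\<close>
      and \<open>13\<close>.\<close>
    have s5: "s \<le> 5 / 11 * q" using sq[of "11 / 5"] t by (simp add: eval_nat_numeral)
    then have qs: "q * s \<le> q * (5 / 11 * q)" by (intro mult_left_mono) auto
    have "(m * s + 1) ^ 3 \<le> 5 / 11 * (real q)\<^sup>2 + 48 / 11 * q + 1"
      unfolding cube using 2 m s5 qs by (simp add: power2_eq_square)
    then have "(real q * m + 1) * (m * s + 1) ^ 3 \<le> (real q + 1) * (5 / 11 * (real q)\<^sup>2 + 48 / 11 * q + 1)"
      using 2 m by (intro mult_mono) (auto simp: s)
    also have "\<dots> < (real q - 1) ^ 4"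
    proof -
      have "(real q - 1) ^ 4 - (real q + 1) * (5 / 11 * (real q)\<^sup>2 + 48 / 11 * q + 1)
        = t ^ 4 + (16 - 5 / 11) * t ^ 3 + (96 - 128 / 11) * t\<^sup>2 + (256 - 964 / 11) * t + (256 - 2256 / 11)"
        unfolding t(2) by (simp add: eval_nat_numeral field_simps)
      also have "\<dots> > 0" using t by (intro add_nonneg_pos add_nonneg_nonneg mult_nonneg_nonneg) auto
      finally show ?thesis by simp
    qed
    moreover have "real e * (real q * m + 1)\<^sup>2 < 2 * (real q - 1) ^ 3"
    proof -
      have "2 * (real q - 1) ^ 3 - real e * (real q * m + 1)\<^sup>2 = 2 * t ^ 3 + 22 * t\<^sup>2 + 72 * t + 56"
        unfolding t(2) m 2 by (simp add: eval_nat_numeral algebra_simps)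
      also have "\<dots> > 0" using t by (intro add_nonneg_pos add_nonneg_nonneg mult_nonneg_nonneg) auto
      finally show ?thesis by simp
    qed
    ultimately show ?thesis by simp
  next
    case 3
    have "q \<ge> 10"
    proof (rule ccontr)
      assume "\<not> q \<ge> 10"
      then have "real q \<le> 9" by simp
      then have "(real q)\<^sup>2 \<le> 9\<^sup>2" by (intro power_mono) auto
      then show False using qm 3 m by simp
    qed
    then have "q \<ge> 13"
    proof -
      have "q \<noteq> 11" "q \<noteq> 12" using dvd 3 by auto
      then show ?thesis using \<open>q \<ge> 10\<close> q10 by linarith
    qed
    then obtain t :: real where t: "t \<ge> 0" "real q = 13 + t" using that[of "real q - 13"] by simp
    have s5: "s \<le> 5 / 18 * q" using sq[of "18 / 5"] t by (simp add: eval_nat_numeral)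
    then have qs: "q * s \<le> q * (5 / 18 * q)" by (intro mult_left_mono) auto
    have "(m * s + 1) ^ 3 \<le> 20 / 9 * (real q)\<^sup>2 + 41 / 3 * q + 1"
      unfolding cube using 3 m s5 qs by (simp add: power2_eq_square)
    then have "(real q * m + 1) * (m * s + 1) ^ 3 \<le> (2 * real q + 1) * (20 / 9 * (real q)\<^sup>2 + 41 / 3 * q + 1)"
      using 3 m by (intro mult_mono) (auto simp: s)
    also have "\<dots> < (real q - 1) ^ 4"
    proof -
      have "(real q - 1) ^ 4 - (2 * real q + 1) * (20 / 9 * (real q)\<^sup>2 + 41 / 3 * q + 1)
        = t ^ 4 + (48 - 40 / 9) * t ^ 3 + (864 - 1826 / 9) * t\<^sup>2 + (6912 - 27337 / 9) * t + (20736 - 14964)"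
        unfolding t(2) by (simp add: eval_nat_numeral field_simps)
      also have "\<dots> > 0" using t by (intro add_nonneg_pos add_nonneg_nonneg mult_nonneg_nonneg) auto
      finally show ?thesis by simp
    qed
    moreover have "real e * (real q * m + 1)\<^sup>2 < 2 * (real q - 1) ^ 3"
    proof -
      have "2 * (real q - 1) ^ 3 - real e * (real q * m + 1)\<^sup>2 = 2 * t ^ 3 + 60 * t\<^sup>2 + 540 * t + 1269"
        unfolding t(2) m 3 by (simp add: eval_nat_numeral algebra_simps)
      also have "\<dots> > 0" using t by (intro add_nonneg_pos add_nonneg_nonneg mult_nonneg_nonneg) auto
      finally show ?thesis by simp
    qed
    ultimately show ?thesis by simp
  next
    case 4
    then have m3: "m \<ge> 3" using m by simp
    \<comment> \<open>Integrality turns \<open>m^6 < q^2\<close> into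
      \<open>m^3 + 1 \<le> q\<close>.\<close>
    have "((e - 1) ^ 3)\<^sup>2 < q\<^sup>2"
    proof -
      have "m = real (e - 1)" using e m by simp
      then have "real (((e - 1) ^ 3)\<^sup>2) < real (q\<^sup>2)" using qm e by (simp add: power_mult[symmetric])
      then show ?thesis by (simp only: of_nat_less_iff)
    qed
    then have "(e - 1) ^ 3 < q" by (rule power2_less_imp_less) simp
    then have "real ((e - 1) ^ 3 + 1) \<le> real q" by (simp only: of_nat_le_iff)
    then have "real q \<ge> m ^ 3 + 1" using m e by simp
    then show ?thesis using four_powers_bounds_large[OF m3 _ s] m by simp
  qed
  then show "(real q * m + 1) * (m * sqrt q + 1) ^ 3 < (real q - 1) ^ 4"
    and "real e * (real q * m + 1)\<^sup>2 < 2 * (real q - 1) ^ 3"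
    by (auto simp: s_def)
qed

text \<open>By Bezout, \<open>y ^ k = 1\<close> and \<open>y ^ (CARD('a) - 1) = 1\<close> give
  \<open>y ^ d = 1\<close> for the gcd \<open>d\<close>, a polynomial equation of degree
  \<open>d\<close>.\<close>

lemma card_roots_of_unity_le:
  assumes "k \<ge> 1"
  shows "card {y :: 'a :: {field, finite}. y ^ k = 1} \<le> gcd k (CARD('a) - 1)"
proof -
  define d where "d = gcd k (CARD('a) - 1)"
  have d: "d \<ge> 1" using assms by (simp add: d_def Suc_le_eq)
  obtain x z where xz: "k * x = (CARD('a) - 1) * z + d"
    using bezout_nat[of k "CARD('a) - 1"] assms unfolding d_def by auto
  let ?P = "monom 1 d - 1 :: 'a poly"
  have "{y :: 'a. y ^ k = 1} \<subseteq> {y. poly ?P y = 0}"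
  proof
    fix y :: 'a assume "y \<in> {y. y ^ k = 1}"
    then have y: "y ^ k = 1" by simp
    then have "y \<noteq> 0" using assms by (metis not_one_le_zero power_0_left zero_neq_one)
    then have "y ^ (CARD('a) - 1) = 1" by (rule power_card_minus_1_finite_field)
    moreover have "y ^ (k * x) = y ^ ((CARD('a) - 1) * z) * y ^ d" by (simp only: xz power_add)
    ultimately have "y ^ d = 1" using y by (simp add: power_mult)
    then show "y \<in> {y. poly ?P y = 0}" by (simp add: poly_monom)
  qed
  then have "card {y :: 'a. y ^ k = 1} \<le> card {y. poly ?P y = 0}" by (intro card_mono) auto
  also have "\<dots> \<le> degree ?P"
  proof (rule card_poly_roots_bound)
    have "coeff ?P d = 1" using d by simp
    then show "?P \<noteq> 0" by (metis coeff_0 zero_neq_one)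
  qed
  also have "\<dots> \<le> d" by (rule degree_diff_le) (auto simp: degree_monom_eq)
  finally show ?thesis by (simp add: d_def)
qed

lemma sum_of_two_kth_powers:
  fixes c :: "'a :: {field, finite}"
  assumes "prime p" and "CARD('a) = p ^ l" and "k \<ge> 1"
    and "(real (gcd k (CARD('a) - 1)) - 1) ^ 4 < CARD('a)"
  shows "\<exists>x y. x ^ k + y ^ k = c"
proof -
  obtain \<psi> :: "'a \<Rightarrow> complex" where \<psi>: "\<And>x y. \<psi> (x + y) = \<psi> x * \<psi> y" "\<And>x. norm (\<psi> x) = 1" "\<exists>x. \<psi> x \<noteq> 1"
    using ex_nontrivial_additive_character[OF assms(1,2)] by blast
  define Q where "Q = real CARD('a)"
  interpret kth_power_sums \<psi> k Q "card {y :: 'a. y ^ k = 1}"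
    by (rule kth_power_sums.intro[OF \<psi> assms(3) Q_def refl])
  have "m ^ 4 \<le> (real (gcd k (CARD('a) - 1)) - 1) ^ 4"
    using card_roots_of_unity_le[OF assms(3), where ?'a = 'a] m_nonneg
    unfolding m_def by (intro power_mono) auto
  then show ?thesis using sum_of_two_powers assms(4) by simp
qed

lemma sum_of_four_nonzero_kth_powers:
  fixes t :: "'a :: {field, finite}"
  assumes "prime p" and "CARD('a) = p ^ l" and "k \<ge> 1"
    and "(real (gcd k (CARD('a) - 1)) - 1) ^ 6 + 6 * gcd k (CARD('a) - 1) \<le> (real CARD('a))\<^sup>2"
  shows "\<exists>x y z w. x \<noteq> 0 \<and> y \<noteq> 0 \<and> z \<noteq> 0 \<and> w \<noteq> 0 \<and> x ^ k + y ^ k + (z ^ k + w ^ k) = t"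
proof -
  obtain \<psi> :: "'a \<Rightarrow> complex" where \<psi>: "\<And>x y. \<psi> (x + y) = \<psi> x * \<psi> y" "\<And>x. norm (\<psi> x) = 1" "\<exists>x. \<psi> x \<noteq> 1"
    using ex_nontrivial_additive_character[OF assms(1,2)] by blast
  define e where "e = card {y :: 'a. y ^ k = 1}"
  define Q where "Q = real CARD('a)"
  interpret kth_power_sums \<psi> k Q e
    by (rule kth_power_sums.intro[OF \<psi> assms(3) Q_def e_def])
  have eg: "e \<le> gcd k (CARD('a) - 1)"
    using card_roots_of_unity_le[OF assms(3), where ?'a = 'a] by (simp add: e_def)
  have "m ^ 6 \<le> (real (gcd k (CARD('a) - 1)) - 1) ^ 6"
    using eg m_nonneg unfolding m_def by (intro power_mono) auto
  then have qm: "m ^ 6 + 6 * real e \<le> (real CARD('a))\<^sup>2" using eg assms(4) by linarith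
  have q10: "CARD('a) \<noteq> 10"
  proof
    assume 10: "CARD('a) = 10"
    then have "p ^ l = 10" using assms(2) by simp
    then have "2 dvd p ^ l" "5 dvd p ^ l" by simp_all
    then have "2 dvd p" "5 dvd p" using prime_dvd_power[of 2 p l] prime_dvd_power[of 5 p l] by simp_all
    then have "2 = p" "5 = p" using assms(1) primes_dvd_imp_eq[of 2 p] primes_dvd_imp_eq[of 5 p] by simp_all
    then show False by simp
  qed
  note num = four_powers_bounds[OF e_pos e_dvd q10 m_def qm]
  show ?thesis
  proof (cases "t = 0")
    case True
    then show ?thesis using sum_of_four_nonzero_powers_zero num(2) by simp
  next
    case False
    then show ?thesis using sum_of_four_nonzero_powers_nonzero num(1) by simp
  qed
qed

section \<open>Powers of triangular matrices\<close>

lemma index_mult_mat_sum: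
  assumes "A \<in> carrier_mat n m" and "B \<in> carrier_mat m r" and "i < n" and "j < r"
  shows "(A * B) $$ (i, j) = (\<Sum>l<m. A $$ (i, l) * B $$ (l, j))"
  using assms by (simp add: scalar_prod_def atLeast0LessThan)

lemma upper_triangular_mult:
  fixes A B :: "'a :: semiring_1 mat"
  assumes A: "A \<in> carrier_mat n n" "upper_triangular A" and B: "B \<in> carrier_mat n n" "upper_triangular B"
  shows "upper_triangular (A * B)" and "i < n \<Longrightarrow> (A * B) $$ (i, i) = A $$ (i, i) * B $$ (i, i)"
proof -
  show "upper_triangular (A * B)"
  proof
    fix i j assume ij: "j < i" "i < dim_row (A * B)"
    then have i: "i < n" using A by simp
    have "A $$ (i, l) * B $$ (l, j) = 0" if "l < n" for l
    proof (cases "l < i")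
      case True
      then have "A $$ (i, l) = 0" using A i by (intro upper_triangularD) auto
      then show ?thesis by simp
    next
      case False
      then have "B $$ (l, j) = 0" using B that ij by (intro upper_triangularD) auto
      then show ?thesis by simp
    qed
    then show "(A * B) $$ (i, j) = 0" using index_mult_mat_sum[OF A(1) B(1) i, of j] i ij by simp
  qed
  assume i: "i < n"
  have "A $$ (i, l) * B $$ (l, i) = (if l = i then A $$ (i, i) * B $$ (i, i) else 0)" if l: "l < n" for l
  proof -
    consider "l < i" | "l = i" | "i < l" by linarith
    then show ?thesis
    proof cases
      case 1
      then have "A $$ (i, l) = 0" using A i by (intro upper_triangularD) auto
      then show ?thesis using 1 by simp
    next
      case 3
      then have "B $$ (l, i) = 0" using B l by (intro upper_triangularD) auto
      then show ?thesis using 3 by simp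
    qed simp
  qed
  then have "(\<Sum>l<n. A $$ (i, l) * B $$ (l, i)) = (\<Sum>l<n. if l = i then A $$ (i, i) * B $$ (i, i) else 0)"
    by (intro sum.cong) auto
  also have "\<dots> = A $$ (i, i) * B $$ (i, i)" using i by simp
  finally show "(A * B) $$ (i, i) = A $$ (i, i) * B $$ (i, i)"
    unfolding index_mult_mat_sum[OF A(1) B(1) i i] .
qed

lemma upper_triangular_pow:
  fixes A :: "'a :: semiring_1 mat"
  assumes A: "A \<in> carrier_mat n n" "upper_triangular A"
  shows "upper_triangular (A ^\<^sub>m j) \<and> (\<forall>i<n. (A ^\<^sub>m j) $$ (i, i) = (A $$ (i, i)) ^ j)"
proof (induction j)
  case (Suc j)
  have Aj: "A ^\<^sub>m j \<in> carrier_mat n n" using A by simp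
  show ?case using upper_triangular_mult[OF Aj _ A] Suc by (auto simp: power_commutes)
qed (use A in auto)

text \<open>The sum of \<open>a^(j-1-i) X^i\<close> over \<open>i < j\<close>, that is, the formal
  quotient of \<open>X^j - a^j\<close> by \<open>X - a\<close>.\<close>

fun geometric_mat :: "'a :: comm_ring_1 mat \<Rightarrow> 'a \<Rightarrow> nat \<Rightarrow> 'a mat" where
  "geometric_mat X a 0 = 0\<^sub>m (dim_row X) (dim_row X)"
| "geometric_mat X a (Suc j) = X ^\<^sub>m j + a \<cdot>\<^sub>m geometric_mat X a j"

lemma geometric_mat_carrier [simp]: "X \<in> carrier_mat n n \<Longrightarrow> geometric_mat X a j \<in> carrier_mat n n"
  by (induction j) auto

lemma smult_one_mat_pow: "(a \<cdot>\<^sub>m 1\<^sub>m n) ^\<^sub>m j = (a :: 'a :: comm_ring_1) ^ j \<cdot>\<^sub>m 1\<^sub>m n"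
proof (induction j)
  case (Suc j)
  have "a ^ j \<cdot>\<^sub>m 1\<^sub>m n * (a \<cdot>\<^sub>m 1\<^sub>m n) = a ^ j \<cdot>\<^sub>m (1\<^sub>m n * (a \<cdot>\<^sub>m 1\<^sub>m n))"
    by (rule mult_smult_assoc_mat[of _ n n]) auto
  also have "\<dots> = a ^ j \<cdot>\<^sub>m (a \<cdot>\<^sub>m 1\<^sub>m n)" by simp
  also have "\<dots> = a ^ Suc j \<cdot>\<^sub>m 1\<^sub>m n" by (intro eq_matI) (auto simp: ac_simps)
  finally show ?case using Suc by simp
qed (auto intro!: eq_matI)

text \<open>The last column of the power depends linearly on \<open>v\<close>, so extending a root
  by one row and column amounts to solving a linear system.\<close>

lemma pow_block_upper_triangular:
  assumes X: "X \<in> carrier_mat n n" and v: "v \<in> carrier_mat n 1"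
  shows "four_block_mat X v (0\<^sub>m 1 n) (a \<cdot>\<^sub>m 1\<^sub>m 1) ^\<^sub>m j =
    four_block_mat (X ^\<^sub>m j) (geometric_mat X a j * v) (0\<^sub>m 1 n) (a ^ j \<cdot>\<^sub>m 1\<^sub>m 1)"
proof (induction j)
  case 0
  have "geometric_mat X a 0 * v = 0\<^sub>m n 1" using X v by simp
  moreover have "a ^ 0 \<cdot>\<^sub>m 1\<^sub>m 1 = 1\<^sub>m 1" by (rule eq_matI) auto
  moreover have "dim_row X = n" using X by simp
  ultimately show ?case by (simp del: geometric_mat.simps One_nat_def power_0)
next
  case (Suc j)
  let ?G = "geometric_mat X a j"
  have G: "?G \<in> carrier_mat n n" using X by simp
  have Xj: "X ^\<^sub>m j \<in> carrier_mat n n" using X by simp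
  have Gv: "?G * v \<in> carrier_mat n 1" using G v by (rule mult_carrier_mat)
  have "four_block_mat X v (0\<^sub>m 1 n) (a \<cdot>\<^sub>m 1\<^sub>m 1) ^\<^sub>m Suc j =
    four_block_mat (X ^\<^sub>m j) (?G * v) (0\<^sub>m 1 n) (a ^ j \<cdot>\<^sub>m 1\<^sub>m 1) * four_block_mat X v (0\<^sub>m 1 n) (a \<cdot>\<^sub>m 1\<^sub>m 1)"
    using Suc by simp
  also have "\<dots> = four_block_mat (X ^\<^sub>m j * X + ?G * v * 0\<^sub>m 1 n) (X ^\<^sub>m j * v + ?G * v * (a \<cdot>\<^sub>m 1\<^sub>m 1))
    (0\<^sub>m 1 n * X + (a ^ j \<cdot>\<^sub>m 1\<^sub>m 1) * 0\<^sub>m 1 n) (0\<^sub>m 1 n * v + (a ^ j \<cdot>\<^sub>m 1\<^sub>m 1) * (a \<cdot>\<^sub>m 1\<^sub>m 1))"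
    by (rule mult_four_block_mat) (use X v Gv in auto)
  also have "X ^\<^sub>m j * X + ?G * v * 0\<^sub>m 1 n = X ^\<^sub>m Suc j"
    using right_mult_zero_mat[OF Gv, of n] right_add_zero_mat[OF mult_carrier_mat[OF Xj X]] by simp
  also have "X ^\<^sub>m j * v + ?G * v * (a \<cdot>\<^sub>m 1\<^sub>m 1) = geometric_mat X a (Suc j) * v"
  proof -
    have "?G * v * (a \<cdot>\<^sub>m 1\<^sub>m 1) = a \<cdot>\<^sub>m (?G * v * 1\<^sub>m 1)" by (rule mult_smult_distrib[OF Gv one_carrier_mat])
    also have "\<dots> = a \<cdot>\<^sub>m ?G * v"
      using mult_smult_assoc_mat[OF G v, of a] right_mult_one_mat[OF Gv] by simp
    finally show ?thesis using add_mult_distrib_mat[OF Xj smult_carrier_mat[OF G] v] by simp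
  qed
  also have "0\<^sub>m 1 n * X + (a ^ j \<cdot>\<^sub>m 1\<^sub>m 1) * 0\<^sub>m 1 n = 0\<^sub>m 1 n" using X by simp
  also have "0\<^sub>m 1 n * v + (a ^ j \<cdot>\<^sub>m 1\<^sub>m 1) * (a \<cdot>\<^sub>m 1\<^sub>m 1) = a ^ Suc j \<cdot>\<^sub>m 1\<^sub>m 1"
    using left_mult_zero_mat[OF v, of 1] smult_one_mat_pow[of a 1 "Suc j"] smult_one_mat_pow[of a 1 j] by simp
  finally show ?case .
qed

text \<open>On the diagonal the geometric sum is a difference quotient of the \<open>j\<close>-th
  power, and becomes its derivative where \<open>X $$ (i, i) = a\<close>.\<close>

lemma geometric_mat_upper_triangular:
  assumes X: "X \<in> carrier_mat n n" "upper_triangular X"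
  shows "upper_triangular (geometric_mat X a j) \<and>
    (\<forall>i<n. (geometric_mat X a j $$ (i, i)) * (X $$ (i, i) - a) = (X $$ (i, i)) ^ j - a ^ j) \<and>
    (\<forall>i<n. X $$ (i, i) = a \<longrightarrow> geometric_mat X a j $$ (i, i) = of_nat j * a ^ (j - 1))"
proof (induction j)
  case 0
  then show ?case using X by auto
next
  case (Suc j)
  let ?G = "geometric_mat X a j"
  have G: "?G \<in> carrier_mat n n" using X by simp
  have Xj: "X ^\<^sub>m j \<in> carrier_mat n n" using X by simp
  note P = upper_triangular_pow[OF X, of j]
  have ent: "geometric_mat X a (Suc j) $$ (i, l) = (X ^\<^sub>m j) $$ (i, l) + a * ?G $$ (i, l)" if "i < n" "l < n" for i l
    using that G Xj by simp
  have "upper_triangular (geometric_mat X a (Suc j))"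
  proof
    fix i l assume il: "l < i" "i < dim_row (geometric_mat X a (Suc j))"
    then have i: "i < n" using geometric_mat_carrier[OF X(1), of a "Suc j"] by (simp only: carrier_matD)
    have "(X ^\<^sub>m j) $$ (i, l) = 0" using P il i Xj by (intro upper_triangularD) auto
    moreover have "?G $$ (i, l) = 0" using Suc il i G by (intro upper_triangularD) auto
    ultimately show "geometric_mat X a (Suc j) $$ (i, l) = 0" using ent[of i l] il i by simp
  qed
  moreover have "(geometric_mat X a (Suc j) $$ (i, i)) * (X $$ (i, i) - a) = (X $$ (i, i)) ^ Suc j - a ^ Suc j" if i: "i < n" for i
  proof -
    have "(geometric_mat X a (Suc j) $$ (i, i)) * (X $$ (i, i) - a) =
        (X $$ (i, i)) ^ j * (X $$ (i, i) - a) + a * (?G $$ (i, i) * (X $$ (i, i) - a))"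
      using ent[OF i i] P i by (simp add: algebra_simps)
    also have "?G $$ (i, i) * (X $$ (i, i) - a) = (X $$ (i, i)) ^ j - a ^ j" using Suc i by blast
    finally show ?thesis by (simp add: algebra_simps)
  qed
  moreover have "geometric_mat X a (Suc j) $$ (i, i) = of_nat (Suc j) * a ^ (Suc j - 1)" if i: "i < n" "X $$ (i, i) = a" for i
  proof -
    have "geometric_mat X a (Suc j) $$ (i, i) = a ^ j + a * (of_nat j * a ^ (j - 1))"
      using ent[OF i(1) i(1)] P i Suc by auto
    then show ?thesis by (cases j) (simp_all add: algebra_simps)
  qed
  ultimately show ?case by blast
qed

text \<open>The off-diagonal column of a \<open>k\<close>-th root is obtained by inverting the triangular matrix
  \<open>\<Sum>i<k. a\<^bsup>k-1-i\<^esup> X\<^sup>i\<close>. Its diagonal entries are nonzero because equal diagonal entries of \<open>T\<close> receive equal roots,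
  by means of the function \<open>f\<close>, and \<open>k\<close> is nonzero in the field.\<close>

lemma ex_kth_root_upper_triangular:
  fixes T :: "'a :: field mat"
  assumes "of_nat k \<noteq> (0 :: 'a)" and "T \<in> carrier_mat n n" and "upper_triangular T"
    and "\<And>i. i < n \<Longrightarrow> T $$ (i, i) \<noteq> 0" and "\<And>i. i < n \<Longrightarrow> f (T $$ (i, i)) ^ k = T $$ (i, i)"
  shows "\<exists>X \<in> carrier_mat n n. upper_triangular X \<and> (\<forall>i<n. X $$ (i, i) = f (T $$ (i, i))) \<and> X ^\<^sub>m k = T"
  using assms(2-5)
proof (induction n arbitrary: T)
  case 0
  then show ?case by (intro bexI[of _ T]) (auto intro!: eq_matI simp: upper_triangular_def)
next
  case (Suc n)
  have k: "k > 0" using assms(1) by (cases k) auto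
  obtain T' u z b where sp: "split_block T n n = (T', u, z, b)" by (cases "split_block T n n") auto
  have dims: "dim_row T = n + 1" "dim_col T = n + 1" using Suc.prems by auto
  note blk = split_block[OF sp dims]
  define c where "c = T $$ (n, n)"
  have T_ent: "T $$ (i, j) = four_block_mat T' u z b $$ (i, j)" for i j by (simp only: blk(5)[symmetric])
  have T'_ent: "T' $$ (i, j) = T $$ (i, j)" if "i < n" "j < n" for i j
    using that T_ent[of i j] blk(1-4) by auto
  have z: "z = 0\<^sub>m 1 n"
  proof (rule eq_matI)
    fix i j assume ij: "i < dim_row (0\<^sub>m 1 n :: 'a mat)" "j < dim_col (0\<^sub>m 1 n :: 'a mat)"
    then have "z $$ (i, j) = T $$ (n, j)" using T_ent[of n j] blk(1-4) by auto
    also have "\<dots> = 0" using Suc.prems ij by (intro upper_triangularD) auto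
    finally show "z $$ (i, j) = 0\<^sub>m 1 n $$ (i, j)" using ij by simp
  qed (use blk in auto)
  have b: "b = c \<cdot>\<^sub>m 1\<^sub>m 1"
  proof (rule eq_matI)
    fix i j assume ij: "i < dim_row (c \<cdot>\<^sub>m 1\<^sub>m 1)" "j < dim_col (c \<cdot>\<^sub>m 1\<^sub>m 1)"
    then show "b $$ (i, j) = (c \<cdot>\<^sub>m 1\<^sub>m 1) $$ (i, j)"
      unfolding c_def using T_ent[of n n] blk(1-4) by auto
  qed (use blk in auto)
  have "\<exists>X \<in> carrier_mat n n. upper_triangular X \<and> (\<forall>i<n. X $$ (i, i) = f (T' $$ (i, i))) \<and> X ^\<^sub>m k = T'"
  proof (rule Suc.IH)
    show "upper_triangular T'"
    proof
      fix i j assume "j < i" "i < dim_row T'"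
      then show "T' $$ (i, j) = 0" using T'_ent[of i j] blk(1) Suc.prems(1,2) upper_triangularD[of T j i] by auto
    qed
  qed (use blk(1) T'_ent Suc.prems in auto)
  then obtain X where X: "X \<in> carrier_mat n n" "upper_triangular X" "X ^\<^sub>m k = T'"
    and Xd: "\<And>i. i < n \<Longrightarrow> X $$ (i, i) = f (T $$ (i, i))" using T'_ent by auto
  define a where "a = f c"
  have ac: "a ^ k = c" "c \<noteq> 0" using Suc.prems(3,4)[of n] by (auto simp: a_def c_def)
  define G where "G = geometric_mat X a k"
  have G: "G \<in> carrier_mat n n" using X by (simp add: G_def)
  note Gt = geometric_mat_upper_triangular[OF X(1,2), of a k, folded G_def]
  have "G $$ (i, i) \<noteq> 0" if i: "i < n" for i
  proof (cases "X $$ (i, i) = a")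
    case True
    have "a \<noteq> 0" using ac k by (metis power_0_left neq0_conv)
    then show ?thesis using Gt i True assms(1) by simp
  next
    case False
    have "f (T $$ (i, i)) ^ k \<noteq> a ^ k"
    proof
      assume "f (T $$ (i, i)) ^ k = a ^ k"
      then have "T $$ (i, i) = c" using Suc.prems(4)[of i] i ac by simp
      then show False using False Xd[OF i] by (simp add: a_def)
    qed
    then show ?thesis using Gt i Xd[OF i] by force
  qed
  then have "det G \<noteq> 0"
    using upper_triangular_imp_det_eq_0_iff[OF G] Gt G by (auto simp: diag_mat_def)
  then have "G \<in> Units (ring_mat TYPE('a) n ())" by (rule det_non_zero_imp_unit[OF G])
  then obtain H where H: "H \<in> carrier_mat n n" "G * H = 1\<^sub>m n" by (auto simp: Units_def ring_mat_def)
  define v where "v = H * u"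
  have v: "v \<in> carrier_mat n 1" using H blk by (simp add: v_def)
  have Gv: "G * v = u" unfolding v_def using assoc_mult_mat[OF G H(1) blk(2)] H(2) blk(2) by simp
  define Y where "Y = four_block_mat X v (0\<^sub>m 1 n) (a \<cdot>\<^sub>m 1\<^sub>m 1)"
  have "Y ^\<^sub>m k = T"
    unfolding Y_def pow_block_upper_triangular[OF X(1) v] G_def[symmetric] Gv X(3) ac(1)
    using blk(5) z b by simp
  moreover have "upper_triangular Y" unfolding Y_def
    by (rule upper_triangular_four_block) (use X in \<open>auto simp: upper_triangular_def\<close>)
  moreover have "Y \<in> carrier_mat (Suc n) (Suc n)" unfolding Y_def using X(1) by auto
  moreover have "Y $$ (i, i) = f (T $$ (i, i))" if "i < Suc n" for i
  proof (cases "i < n")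
    case True
    then show ?thesis unfolding Y_def using X(1) Xd by auto
  next
    case False
    then have "i = n" using that by simp
    then show ?thesis unfolding Y_def using X(1) by (auto simp: a_def c_def)
  qed
  ultimately show ?case by blast
qed

lemma transpose_mat_pow:
  fixes A :: "'a :: comm_semiring_1 mat"
  assumes A: "A \<in> carrier_mat n n"
  shows "(transpose_mat A) ^\<^sub>m k = transpose_mat (A ^\<^sub>m k)"
proof (induction k)
  case (Suc k)
  have Ak: "A ^\<^sub>m k \<in> carrier_mat n n" using A by simp
  have "A ^\<^sub>m k * A = A * A ^\<^sub>m k"
  proof (induction k)
    case (Suc k)
    have "A ^\<^sub>m k \<in> carrier_mat n n" using A by simp
    then show ?case using Suc assoc_mult_mat[OF A _ A, of "A ^\<^sub>m k"] by simp
  qed (use A in simp)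
  then show ?case using Suc transpose_mult[OF A Ak] by simp
qed (use A in simp)

section \<open>Prescribing the diagonal of a nonscalar matrix\<close>

text \<open>Conjugation by the transvection \<open>I + x y\<^sup>T\<close>, whose inverse is \<open>I - x y\<^sup>T\<close> as \<open>y\<^sup>T x = 0\<close>.\<close>

lemma similar_mat_transvection:
  fixes C :: "'a :: comm_ring_1 mat" and x y :: "nat \<Rightarrow> 'a"
  assumes C: "C \<in> carrier_mat n n" and xy: "(\<Sum>i<n. y i * x i) = 0"
  obtains D where "D \<in> carrier_mat n n" and "similar_mat D C"
    and "(\<Sum>a<n. D $$ (a, a)) = (\<Sum>a<n. C $$ (a, a))"
    and "\<And>a b. a < n \<Longrightarrow> b < n \<Longrightarrow> D $$ (a, b) = C $$ (a, b) + (\<Sum>j<n. C $$ (a, j) * x j) * y b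
      - x a * ((\<Sum>i<n. y i * C $$ (i, b)) + (\<Sum>i<n. y i * (\<Sum>j<n. C $$ (i, j) * x j)) * y b)"
proof -
  define E where "E s = mat n n (\<lambda>(a, b). (if a = b then 1 else 0) + s * x a * y b)" for s :: 'a
  have Ec: "E s \<in> carrier_mat n n" for s by (simp add: E_def)
  have right: "(M * E s) $$ (a, b) = M $$ (a, b) + s * (\<Sum>j<n. M $$ (a, j) * x j) * y b"
    if "M \<in> carrier_mat n n" "a < n" "b < n" for M s a b
  proof -
    have "(M * E s) $$ (a, b) = (\<Sum>l<n. M $$ (a, l) * E s $$ (l, b))"
      by (rule index_mult_mat_sum[OF that(1) Ec that(2,3)])
    also have "\<dots> = (\<Sum>l<n. (if l = b then M $$ (a, b) else 0) + s * (M $$ (a, l) * x l) * y b)"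
      by (intro sum.cong) (use that in \<open>auto simp: E_def algebra_simps\<close>)
    also have "\<dots> = M $$ (a, b) + s * (\<Sum>j<n. M $$ (a, j) * x j) * y b"
      using that by (simp add: sum.distrib sum_distrib_left sum_distrib_right)
    finally show ?thesis .
  qed
  have left: "(E s * M) $$ (a, b) = M $$ (a, b) + s * x a * (\<Sum>i<n. y i * M $$ (i, b))"
    if "M \<in> carrier_mat n n" "a < n" "b < n" for M s a b
  proof -
    have "(E s * M) $$ (a, b) = (\<Sum>l<n. E s $$ (a, l) * M $$ (l, b))"
      by (rule index_mult_mat_sum[OF Ec that])
    also have "\<dots> = (\<Sum>l<n. (if l = a then M $$ (a, b) else 0) + s * x a * (y l * M $$ (l, b)))"
      by (intro sum.cong) (use that in \<open>auto simp: E_def algebra_simps\<close>)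
    also have "\<dots> = M $$ (a, b) + s * x a * (\<Sum>i<n. y i * M $$ (i, b))"
      using that by (simp add: sum.distrib sum_distrib_left)
    finally show ?thesis .
  qed
  have inv: "E s * E (- s) = 1\<^sub>m n" for s
  proof (rule eq_matI)
    fix a b assume ab: "a < dim_row (1\<^sub>m n :: 'a mat)" "b < dim_col (1\<^sub>m n :: 'a mat)"
    then have a: "a < n" and b: "b < n" by auto
    have "(\<Sum>i<n. y i * E (- s) $$ (i, b)) = (\<Sum>i<n. (if i = b then y b else 0) - s * y b * (y i * x i))"
      by (intro sum.cong) (use b in \<open>auto simp: E_def algebra_simps\<close>)
    also have "\<dots> = y b" using b xy by (simp add: sum_subtractf flip: sum_distrib_left)
    finally have "(E s * E (- s)) $$ (a, b) = E (- s) $$ (a, b) + s * x a * y b"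
      using left[OF Ec a b] by simp
    also have "\<dots> = (if a = b then 1 else 0)" using a b by (simp add: E_def)
    finally show "(E s * E (- s)) $$ (a, b) = 1\<^sub>m n $$ (a, b)" using a b by simp
  qed (auto simp: E_def)
  define D where "D = E (- 1) * C * E 1"
  have CE: "C * E 1 \<in> carrier_mat n n" using C Ec by simp
  have D: "D \<in> carrier_mat n n" unfolding D_def by (intro mult_carrier_mat[of _ n n] Ec C)
  have D_alt: "D = E (- 1) * (C * E 1)" unfolding D_def by (rule assoc_mult_mat[OF Ec C Ec])
  have "similar_mat D C"
    by (rule similar_matI[of _ _ "E (- 1)" "E 1" n]) (use C D Ec inv[of 1] inv[of "- 1"] D_def in auto)
  moreover have ent: "D $$ (a, b) = C $$ (a, b) + (\<Sum>j<n. C $$ (a, j) * x j) * y b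
      - x a * ((\<Sum>i<n. y i * C $$ (i, b)) + (\<Sum>i<n. y i * (\<Sum>j<n. C $$ (i, j) * x j)) * y b)"
    if "a < n" "b < n" for a b
  proof -
    have "D $$ (a, b) = (C * E 1) $$ (a, b) - x a * (\<Sum>i<n. y i * (C * E 1) $$ (i, b))"
      unfolding D_alt using left[OF CE that, of "- 1"] by simp
    also have "(\<Sum>i<n. y i * (C * E 1) $$ (i, b)) = (\<Sum>i<n. y i * C $$ (i, b) + (y i * (\<Sum>j<n. C $$ (i, j) * x j)) * y b)"
      by (intro sum.cong) (use right[OF C _ that(2)] in \<open>auto simp: algebra_simps\<close>)
    also have "\<dots> = (\<Sum>i<n. y i * C $$ (i, b)) + (\<Sum>i<n. y i * (\<Sum>j<n. C $$ (i, j) * x j)) * y b"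
      by (simp only: sum.distrib sum_distrib_right)
    finally show ?thesis using right[OF C that, of 1] by simp
  qed
  moreover have "(\<Sum>a<n. D $$ (a, a)) = (\<Sum>a<n. C $$ (a, a))"
  proof -
    \<comment> \<open>The trace is computed directly: the two terms linear in the transvection both
      sum to \<open>s\<close> and cancel, and the remaining one carries the factor
      \<open>y\<^sup>T x = 0\<close>.\<close>
    define s where "s = (\<Sum>i<n. y i * (\<Sum>j<n. C $$ (i, j) * x j))"
    have 1: "(\<Sum>a<n. (\<Sum>j<n. C $$ (a, j) * x j) * y a) = s" by (simp add: s_def mult.commute)
    have "(\<Sum>a<n. x a * (\<Sum>i<n. y i * C $$ (i, a))) = (\<Sum>a<n. \<Sum>i<n. y i * (C $$ (i, a) * x a))"
      by (simp add: sum_distrib_left ac_simps)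
    also have "\<dots> = s" unfolding s_def sum_distrib_left by (rule sum.swap)
    finally have 2: "(\<Sum>a<n. x a * (\<Sum>i<n. y i * C $$ (i, a))) = s" .
    have "(\<Sum>a<n. D $$ (a, a)) = (\<Sum>a<n. C $$ (a, a) + (\<Sum>j<n. C $$ (a, j) * x j) * y a
        - (x a * (\<Sum>i<n. y i * C $$ (i, a)) + s * (y a * x a)))"
      by (intro sum.cong) (auto simp: ent s_def algebra_simps)
    also have "\<dots> = (\<Sum>a<n. C $$ (a, a)) + s - (s + s * 0)"
      unfolding sum_subtractf sum.distrib 1 2 sum_distrib_left[symmetric] xy ..
    finally show ?thesis by simp
  qed
  ultimately show ?thesis using that D by blast
qed

lemma sum_lessThan_delta:
  fixes f :: "nat \<Rightarrow> 'a :: semiring_1"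
  assumes "i < n"
  shows "(\<Sum>j<n. f j * (if j = i then 1 else 0)) = f i"
    and "(\<Sum>j<n. (if j = i then 1 else 0) * f j) = f i"
proof -
  have "(\<Sum>j<n. f j * (if j = i then 1 else 0)) = (\<Sum>j<n. if j = i then f i else 0)"
    by (intro sum.cong) auto
  then show "(\<Sum>j<n. f j * (if j = i then 1 else 0)) = f i" using assms by simp
  have "(\<Sum>j<n. (if j = i then 1 else 0) * f j) = (\<Sum>j<n. if j = i then f i else 0)"
    by (intro sum.cong) auto
  then show "(\<Sum>j<n. (if j = i then 1 else 0) * f j) = f i" using assms by simp
qed

text \<open>A nonscalar diagonal matrix has two different diagonal entries; the transvection with
  unit vectors at \<open>i\<close> and \<open>j\<close> moves their difference to position
  \<open>(i, j)\<close>.\<close>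

lemma nonscalar_similar_offdiag_nonzero:
  fixes C :: "'a :: field mat"
  assumes C: "C \<in> carrier_mat n n" and ns: "\<And>a. C \<noteq> a \<cdot>\<^sub>m 1\<^sub>m n"
  obtains D i j where "D \<in> carrier_mat n n" "similar_mat D C"
    "(\<Sum>a<n. D $$ (a, a)) = (\<Sum>a<n. C $$ (a, a))" "i < n" "j < n" "i \<noteq> j" "D $$ (i, j) \<noteq> 0"
proof (cases "\<exists>i j. i < n \<and> j < n \<and> i \<noteq> j \<and> C $$ (i, j) \<noteq> 0")
  case True
  then show ?thesis using that C similar_mat_refl[OF C] by blast
next
  case False
  have "\<exists>i j. i < n \<and> j < n \<and> C $$ (i, i) \<noteq> C $$ (j, j)"
  proof (rule ccontr)
    assume no: "\<not> ?thesis"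
    have "C = C $$ (0, 0) \<cdot>\<^sub>m 1\<^sub>m n"
    proof (rule eq_matI)
      fix a b assume "a < dim_row (C $$ (0, 0) \<cdot>\<^sub>m 1\<^sub>m n)" "b < dim_col (C $$ (0, 0) \<cdot>\<^sub>m 1\<^sub>m n)"
      then have ab: "a < n" "b < n" by auto
      then have "0 < n" by simp
      then have "C $$ (a, a) = C $$ (0, 0)" using no ab by blast
      moreover have "C $$ (a, b) = 0" if "a \<noteq> b" using False ab that by blast
      ultimately show "C $$ (a, b) = (C $$ (0, 0) \<cdot>\<^sub>m 1\<^sub>m n) $$ (a, b)" using ab by (cases "a = b") simp_all
    qed (use C in auto)
    then show False using ns by blast
  qed
  then obtain i j where ij: "i < n" "j < n" "C $$ (i, i) \<noteq> C $$ (j, j)" by blast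
  then have "i \<noteq> j" by auto
  define x y :: "nat \<Rightarrow> 'a" where "x l = (if l = i then 1 else 0)" and "y l = (if l = j then 1 else 0)" for l
  have "(\<Sum>l<n. y l * x l) = 0" using \<open>i \<noteq> j\<close> by (intro sum.neutral) (auto simp: x_def y_def)
  from similar_mat_transvection[OF C this] obtain D where D: "D \<in> carrier_mat n n" "similar_mat D C"
    "(\<Sum>a<n. D $$ (a, a)) = (\<Sum>a<n. C $$ (a, a))"
    and ent: "\<And>a b. a < n \<Longrightarrow> b < n \<Longrightarrow> D $$ (a, b) = C $$ (a, b) + (\<Sum>j<n. C $$ (a, j) * x j) * y b
      - x a * ((\<Sum>i<n. y i * C $$ (i, b)) + (\<Sum>i<n. y i * (\<Sum>j<n. C $$ (i, j) * x j)) * y b)" by blast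
  have "x i = 1" "y j = 1" by (simp_all add: x_def y_def)
  moreover have "(\<Sum>l<n. C $$ (a, l) * x l) = C $$ (a, i)" for a
    unfolding x_def by (rule sum_lessThan_delta(1)[OF ij(1)])
  moreover have "(\<Sum>l<n. y l * f l) = f j" for f :: "nat \<Rightarrow> 'a"
    unfolding y_def by (rule sum_lessThan_delta(2)[OF ij(2)])
  ultimately have "D $$ (i, j) = C $$ (i, j) + C $$ (i, i) - (C $$ (j, j) + C $$ (j, i))"
    using ent[OF ij(1,2)] by simp
  moreover have "C $$ (i, j) = 0" "C $$ (j, i) = 0" using False ij \<open>i \<noteq> j\<close> by blast+
  ultimately have "D $$ (i, j) = C $$ (i, i) - C $$ (j, j)" by simp
  then show ?thesis using that[OF D ij(1,2) \<open>i \<noteq> j\<close>] ij(3) by simp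
qed

text \<open>\<open>y\<close> marks the off-diagonal zeros of row \<open>i\<close>, and the
  transvection adds the nonzero entry \<open>B $$ (i, j)\<close> at exactly these places. As
  \<open>x i = 0\<close>, the row operation leaves row \<open>i\<close> alone.\<close>

lemma nonscalar_similar_row_nonzero:
  fixes C :: "'a :: field mat"
  assumes C: "C \<in> carrier_mat n n" and ns: "\<And>a. C \<noteq> a \<cdot>\<^sub>m 1\<^sub>m n"
  obtains D i where "D \<in> carrier_mat n n" "similar_mat D C"
    "(\<Sum>a<n. D $$ (a, a)) = (\<Sum>a<n. C $$ (a, a))" "i < n" "\<And>b. b < n \<Longrightarrow> b \<noteq> i \<Longrightarrow> D $$ (i, b) \<noteq> 0"
proof -
  obtain B i j where B: "B \<in> carrier_mat n n" "similar_mat B C"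
    "(\<Sum>a<n. B $$ (a, a)) = (\<Sum>a<n. C $$ (a, a))" and ij: "i < n" "j < n" "i \<noteq> j" "B $$ (i, j) \<noteq> 0"
    using nonscalar_similar_offdiag_nonzero[OF C ns] .
  define x y :: "nat \<Rightarrow> 'a" where "x l = (if l = j then 1 else 0)"
    and "y l = (if l \<noteq> i \<and> B $$ (i, l) = 0 then 1 else 0)" for l
  have "(\<Sum>l<n. y l * x l) = 0" using ij by (intro sum.neutral) (auto simp: x_def y_def)
  from similar_mat_transvection[OF B(1) this] obtain D where D: "D \<in> carrier_mat n n" "similar_mat D B"
    "(\<Sum>a<n. D $$ (a, a)) = (\<Sum>a<n. B $$ (a, a))"
    and ent: "\<And>a b. a < n \<Longrightarrow> b < n \<Longrightarrow> D $$ (a, b) = B $$ (a, b) + (\<Sum>j<n. B $$ (a, j) * x j) * y b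
      - x a * ((\<Sum>i<n. y i * B $$ (i, b)) + (\<Sum>i<n. y i * (\<Sum>j<n. B $$ (i, j) * x j)) * y b)" by blast
  have "(\<Sum>l<n. B $$ (i, l) * x l) = B $$ (i, j)" unfolding x_def by (rule sum_lessThan_delta(1)[OF ij(2)])
  moreover have "x i = 0" using ij by (simp add: x_def)
  ultimately have "D $$ (i, b) = B $$ (i, b) + B $$ (i, j) * y b" if "b < n" for b
    using ent[OF ij(1) that] by simp
  then have "D $$ (i, b) \<noteq> 0" if "b < n" "b \<noteq> i" for b using that ij(4) by (auto simp: y_def)
  then show ?thesis using that[OF D(1) similar_mat_trans[OF D(2) B(2)] _ ij(1)] D(3) B(3) by simp
qed

text \<open>With \<open>y\<close> the unit vector at \<open>i\<close>, the entry
  \<open>(a, a)\<close> changes by \<open>- x a * B $$ (i, a)\<close> for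
  \<open>a \<noteq> i\<close>, and \<open>B $$ (i, a)\<close> is invertible. The entry at
  \<open>i\<close> is then forced by the trace.\<close>

lemma nonscalar_similar_prescribed_diagonal:
  fixes C :: "'a :: field mat"
  assumes C: "C \<in> carrier_mat n n" and ns: "\<And>a. C \<noteq> a \<cdot>\<^sub>m 1\<^sub>m n"
    and tr: "(\<Sum>a<n. c a) = (\<Sum>a<n. C $$ (a, a))"
  obtains D where "D \<in> carrier_mat n n" "similar_mat D C" "\<And>a. a < n \<Longrightarrow> D $$ (a, a) = c a"
proof -
  obtain B i where B: "B \<in> carrier_mat n n" "similar_mat B C"
    "(\<Sum>a<n. B $$ (a, a)) = (\<Sum>a<n. C $$ (a, a))" and i: "i < n" "\<And>b. b < n \<Longrightarrow> b \<noteq> i \<Longrightarrow> B $$ (i, b) \<noteq> 0"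
    by (rule nonscalar_similar_row_nonzero[OF C ns]) blast
  define x y :: "nat \<Rightarrow> 'a" where "x l = (if l = i then 0 else (B $$ (l, l) - c l) / B $$ (i, l))"
    and "y l = (if l = i then 1 else 0)" for l
  have "(\<Sum>l<n. y l * x l) = 0" by (intro sum.neutral) (auto simp: x_def y_def)
  from similar_mat_transvection[OF B(1) this] obtain D where D: "D \<in> carrier_mat n n" "similar_mat D B"
    "(\<Sum>a<n. D $$ (a, a)) = (\<Sum>a<n. B $$ (a, a))"
    and ent: "\<And>a b. a < n \<Longrightarrow> b < n \<Longrightarrow> D $$ (a, b) = B $$ (a, b) + (\<Sum>j<n. B $$ (a, j) * x j) * y b
      - x a * ((\<Sum>i<n. y i * B $$ (i, b)) + (\<Sum>i<n. y i * (\<Sum>j<n. B $$ (i, j) * x j)) * y b)" by blast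
  have off: "D $$ (a, a) = c a" if a: "a < n" "a \<noteq> i" for a
  proof -
    have "D $$ (a, a) = B $$ (a, a) - x a * B $$ (i, a)"
    proof -
      have "(\<Sum>l<n. y l * B $$ (l, a)) = B $$ (i, a)" unfolding y_def by (rule sum_lessThan_delta(2)[OF i(1)])
      moreover have "y a = 0" using a by (simp add: y_def)
      ultimately show ?thesis using ent[OF a(1) a(1)] by simp
    qed
    then show ?thesis using i(2)[OF a] a by (simp add: x_def)
  qed
  have "(\<Sum>a<n. D $$ (a, a)) = (\<Sum>a<n. c a)" using D(3) B(3) tr by simp
  then have "D $$ (i, i) + (\<Sum>a\<in>{..<n} - {i}. D $$ (a, a)) = c i + (\<Sum>a\<in>{..<n} - {i}. c a)"
    using i(1) by (simp add: sum.remove[of "{..<n}" i])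
  moreover have "(\<Sum>a\<in>{..<n} - {i}. D $$ (a, a)) = (\<Sum>a\<in>{..<n} - {i}. c a)"
    by (intro sum.cong) (use off in auto)
  ultimately have "D $$ (i, i) = c i" by simp
  then have "D $$ (a, a) = c a" if "a < n" for a using off that by (cases "a = i") auto
  then show ?thesis using that[OF D(1) similar_mat_trans[OF D(2) B(2)]] by blast
qed

lemma nonscalar_sum_of_two_kth_powers:
  fixes C :: "'a :: field mat"
  assumes k: "of_nat k \<noteq> (0 :: 'a)" and n: "n \<ge> 2"
    and four: "\<And>t :: 'a. \<exists>x y z w. x \<noteq> 0 \<and> y \<noteq> 0 \<and> z \<noteq> 0 \<and> w \<noteq> 0 \<and> x ^ k + y ^ k + (z ^ k + w ^ k) = t"
    and C: "C \<in> carrier_mat n n" and ns: "\<And>a. C \<noteq> a \<cdot>\<^sub>m 1\<^sub>m n"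
  shows "\<exists>A \<in> carrier_mat n n. \<exists>B \<in> carrier_mat n n. C = A ^\<^sub>m k + B ^\<^sub>m k"
proof -
  obtain x y z w where nz: "x \<noteq> 0" "y \<noteq> 0" "z \<noteq> 0" "w \<noteq> 0"
    and xyzw: "x ^ k + y ^ k + (z ^ k + w ^ k) = (\<Sum>a<n. C $$ (a, a)) - (\<Sum>a=2..<n. 2)" using four by blast
  \<comment> \<open>Positions \<open>0\<close> and \<open>1\<close> carry the four powers; every
    other diagonal entry is \<open>1 + 1\<close>, which accounts for the sum of twos subtracted from
    the trace.\<close>
  define \<alpha> \<beta> :: "nat \<Rightarrow> 'a" where "\<alpha> a = (if a = 0 then x else if a = 1 then z else 1)"
    and "\<beta> a = (if a = 0 then y else if a = 1 then w else 1)" for a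
  have nz': "\<alpha> a \<noteq> 0" "\<beta> a \<noteq> 0" for a using nz by (auto simp: \<alpha>_def \<beta>_def)
  have "(\<Sum>a<n. \<alpha> a ^ k + \<beta> a ^ k) = (\<Sum>a<n. C $$ (a, a))"
  proof -
    have "{..<n} = insert 0 (insert 1 {2..<n})" using n by auto
    then have "(\<Sum>a<n. \<alpha> a ^ k + \<beta> a ^ k) = (\<alpha> 0 ^ k + \<beta> 0 ^ k) + ((\<alpha> 1 ^ k + \<beta> 1 ^ k) + (\<Sum>a=2..<n. \<alpha> a ^ k + \<beta> a ^ k))"
      by simp
    also have "(\<Sum>a=2..<n. \<alpha> a ^ k + \<beta> a ^ k) = (\<Sum>a=2..<n. 2)"
      by (intro sum.cong) (auto simp: \<alpha>_def \<beta>_def)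
    finally show ?thesis using xyzw by (simp add: \<alpha>_def \<beta>_def algebra_simps)
  qed
  from nonscalar_similar_prescribed_diagonal[OF C ns this] obtain D
    where D: "D \<in> carrier_mat n n" "similar_mat D C" "\<And>a. a < n \<Longrightarrow> D $$ (a, a) = \<alpha> a ^ k + \<beta> a ^ k" by blast
  define f :: "'a \<Rightarrow> 'a" where "f c = (SOME r. r ^ k = c)" for c
  have f: "f (r ^ k) ^ k = r ^ k" for r unfolding f_def by (rule someI) simp
  define T where "T = mat n n (\<lambda>(i, j). if i < j then D $$ (i, j) else if i = j then \<alpha> i ^ k else 0)"
  \<comment> \<open>The lower part is stored transposed, so that the root lemma for upper triangular
    matrices applies to both summands.\<close>
  define S where "S = mat n n (\<lambda>(i, j). if i < j then D $$ (j, i) else if i = j then \<beta> i ^ k else 0)"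
  have "\<exists>X \<in> carrier_mat n n. upper_triangular X \<and> (\<forall>i<n. X $$ (i, i) = f (T $$ (i, i))) \<and> X ^\<^sub>m k = T"
    by (rule ex_kth_root_upper_triangular[OF k]) (use f nz' in \<open>auto simp: T_def\<close>)
  then obtain X where X: "X \<in> carrier_mat n n" "X ^\<^sub>m k = T" by blast
  have "\<exists>X \<in> carrier_mat n n. upper_triangular X \<and> (\<forall>i<n. X $$ (i, i) = f (S $$ (i, i))) \<and> X ^\<^sub>m k = S"
    by (rule ex_kth_root_upper_triangular[OF k]) (use f nz' in \<open>auto simp: S_def\<close>)
  then obtain Y where Y: "Y \<in> carrier_mat n n" "Y ^\<^sub>m k = S" by blast
  have DTS: "D = T + transpose_mat S"
    by (rule eq_matI) (use D in \<open>auto simp: T_def S_def\<close>)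
  obtain P R where "similar_mat_wit C D P R" using similar_mat_sym[OF D(2)] by (auto simp: similar_mat_def)
  then have PR: "P \<in> carrier_mat n n" "R \<in> carrier_mat n n" "P * R = 1\<^sub>m n" "R * P = 1\<^sub>m n" "C = P * D * R"
    using similar_mat_witD2[OF C] by auto
  have conj: "(P * M * R) ^\<^sub>m k = P * M ^\<^sub>m k * R" if "M \<in> carrier_mat n n" for M
  proof (rule similar_mat_wit_pow_id)
    show "similar_mat_wit (P * M * R) M P R"
      by (rule similar_mat_witI[OF PR(3,4) refl]) (use PR that in auto)
  qed
  have Yt: "transpose_mat Y \<in> carrier_mat n n" using Y by simp
  have cT: "T \<in> carrier_mat n n" and cS: "transpose_mat S \<in> carrier_mat n n" by (auto simp: T_def S_def)
  have "C = P * (T + transpose_mat S) * R" using PR(5) DTS by simp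
  also have "\<dots> = P * T * R + P * transpose_mat S * R"
    using PR cT cS by (simp add: mult_add_distrib_mat[of _ n n] add_mult_distrib_mat[of _ n n])
  also have "\<dots> = (P * X * R) ^\<^sub>m k + (P * transpose_mat Y * R) ^\<^sub>m k"
    using conj[OF X(1)] conj[OF Yt] X(2) Y(2) transpose_mat_pow[OF Y(1), of k] by simp
  finally show ?thesis using PR X Yt by (intro bexI[of _ "P * X * R"] bexI[of _ "P * transpose_mat Y * R"]) auto
qed

section \<open>Extensions of degree two and three\<close>

text \<open>The map takes the same value at \<open>0\<close> and \<open>1\<close>, so on a finite
  field it is not onto. For \<open>r = 2, 3\<close> this yields an irreducible polynomial
  \<open>X^r - X - c\<close> uniformly in all characteristics.\<close>

lemma ex_not_power_minus_self:
  assumes "r > 0"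
  shows "\<exists>c :: 'a :: {field, finite}. \<forall>x. x ^ r - x \<noteq> c"
proof (rule ccontr)
  assume "\<not> ?thesis"
  then have "surj (\<lambda>x :: 'a. x ^ r - x)" by (auto simp: surj_def) metis
  then have "inj (\<lambda>x :: 'a. x ^ r - x)" by (simp add: finite_UNIV_surj_inj)
  moreover have "(0 :: 'a) ^ r - 0 = 1 ^ r - 1" using assms by (simp add: zero_power)
  ultimately show False by (metis (no_types, lifting) injD zero_neq_one)
qed

text \<open>The constants depend on the base type alone, so that the extensions can be type
  constructors and the results on finite field types apply to them.\<close>

definition quad_const :: "'a :: {field, finite}" where "quad_const = (SOME c. \<forall>x. x ^ 2 - x \<noteq> c)"
definition cubic_const :: "'a :: {field, finite}" where "cubic_const = (SOME c. \<forall>x. x ^ 3 - x \<noteq> c)"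

lemma quad_const: "x ^ 2 - x \<noteq> quad_const"
  using someI_ex[OF ex_not_power_minus_self[of 2, where ?'a = 'a]] by (simp add: quad_const_def)

lemma cubic_const: "x ^ 3 - x \<noteq> cubic_const"
  using someI_ex[OF ex_not_power_minus_self[of 3, where ?'a = 'a]] by (simp add: cubic_const_def)

text \<open>\<open>Quad a b\<close> stands for \<open>a + b \<alpha>\<close> with \<open>\<alpha>\<^sup>2 = \<alpha> + c\<close>; the conjugate of \<open>\<alpha>\<close> is \<open>1 - \<alpha>\<close>.\<close>

datatype 'a quad_ext = Quad 'a 'a

instantiation quad_ext :: ("{field, finite}") field
begin

definition "0 = Quad 0 0"
definition "1 = Quad 1 0"
fun plus_quad_ext where "Quad a b + Quad a' b' = Quad (a + a') (b + b')"
fun minus_quad_ext where "Quad a b - Quad a' b' = Quad (a - a') (b - b')"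
fun uminus_quad_ext where "- Quad a b = Quad (- a) (- b)"
fun times_quad_ext where
  "Quad a b * Quad a' b' = Quad (a * a' + quad_const * b * b') (a * b' + b * a' + b * b')"
fun inverse_quad_ext where
  "inverse (Quad a b) = (let N = a * a + a * b - quad_const * b * b in Quad ((a + b) / N) (- b / N))"
definition "u div v = u * inverse v" for u v :: "'a quad_ext"

text \<open>This is the norm of \<open>a + b \<alpha>\<close>; divided by \<open>b^2\<close> it is
  the value of \<open>X^2 - X - c\<close> at \<open>- a / b\<close>.\<close>

lemma quad_norm_nonzero:
  fixes a b :: 'a
  assumes "Quad a b \<noteq> 0"
  shows "a * a + a * b - quad_const * b * b \<noteq> 0"
proof (cases "b = 0")
  case True
  then show ?thesis using assms by (simp add: zero_quad_ext_def)
next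
  case False
  have "a * a + a * b - quad_const * b * b = ((- a / b) ^ 2 - (- a / b) - quad_const) * (b * b)"
    using False by (simp add: field_simps power2_eq_square)
  then show ?thesis using False quad_const[of "- a / b"] by simp
qed

instance
proof
  fix u v w :: "'a quad_ext"
  show "u * v * w = u * (v * w)"
    by (cases u; cases v; cases w) (simp add: algebra_simps)
  show "u * v = v * u"
    by (cases u; cases v) (simp add: algebra_simps)
  show "(u + v) * w = u * w + v * w"
    by (cases u; cases v; cases w) (simp add: algebra_simps)
  show "u + v + w = u + (v + w)" by (cases u; cases v; cases w) simp
  show "u + v = v + u" by (cases u; cases v) simp
  show "0 + u = u" by (cases u) (simp add: zero_quad_ext_def)
  show "1 * u = u" by (cases u) (simp add: one_quad_ext_def)
  show "- u + u = 0" by (cases u) (simp add: zero_quad_ext_def)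
  show "u - v = u + - v" by (cases u; cases v) simp
  show "(0 :: 'a quad_ext) \<noteq> 1" by (simp add: zero_quad_ext_def one_quad_ext_def)
  show "u div v = u * inverse v" by (rule divide_quad_ext_def)
  show "inverse (0 :: 'a quad_ext) = 0" by (simp add: zero_quad_ext_def)
  show "inverse u * u = 1" if "u \<noteq> 0"
  proof (cases u)
    case (Quad a b)
    let ?N = "a * a + a * b - quad_const * b * b"
    have N: "?N \<noteq> 0" using quad_norm_nonzero that Quad by simp
    have "inverse u * u = Quad ((a + b) / ?N * a + quad_const * (- b / ?N) * b)
        ((a + b) / ?N * b + (- b / ?N) * a + (- b / ?N) * b)"
      by (simp add: Quad Let_def)
    also have "(a + b) / ?N * a + quad_const * (- b / ?N) * b = ?N / ?N"
      by (simp add: algebra_simps flip: add_divide_distrib diff_divide_distrib)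
    also have "(a + b) / ?N * b + (- b / ?N) * a + (- b / ?N) * b = 0"
      by (simp add: algebra_simps flip: add_divide_distrib diff_divide_distrib)
    finally show ?thesis using N by (simp add: one_quad_ext_def)
  qed
qed

end

lemma UNIV_quad_ext: "UNIV = (\<lambda>(a, b). Quad a b) ` (UNIV \<times> UNIV)"
  by (auto simp: image_def) (metis quad_ext.exhaust)

instance quad_ext :: ("{field, finite}") finite
  by standard (simp add: UNIV_quad_ext)

lemma card_quad_ext: "CARD('a :: {field, finite} quad_ext) = CARD('a) ^ 2"
  unfolding UNIV_quad_ext
  by (subst card_image) (auto simp: inj_on_def card_cartesian_product power2_eq_square)

text \<open>\<open>Cubic a b d\<close> stands for \<open>a + b \<alpha> + d \<alpha>\<^sup>2\<close> with \<open>\<alpha>\<^sup>3 = \<alpha> + c\<close>.\<close>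

datatype 'a cubic_ext = Cubic 'a 'a 'a

instantiation cubic_ext :: ("{field, finite}") comm_ring_1
begin

definition "0 = Cubic 0 0 0"
definition "1 = Cubic 1 0 0"
fun plus_cubic_ext where "Cubic a b d + Cubic a' b' d' = Cubic (a + a') (b + b') (d + d')"
fun minus_cubic_ext where "Cubic a b d - Cubic a' b' d' = Cubic (a - a') (b - b') (d - d')"
fun uminus_cubic_ext where "- Cubic a b d = Cubic (- a) (- b) (- d)"
fun times_cubic_ext where
  "Cubic a b d * Cubic a' b' d' = Cubic (a * a' + cubic_const * (b * d' + d * b'))
    (a * b' + b * a' + (b * d' + d * b') + cubic_const * (d * d')) (a * d' + b * b' + d * a' + d * d')"

instance
proof
  fix u v w :: "'a cubic_ext"
  show "u * v * w = u * (v * w)"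
    by (cases u; cases v; cases w) (simp add: algebra_simps)
  show "u * v = v * u"
    by (cases u; cases v) (simp add: algebra_simps)
  show "(u + v) * w = u * w + v * w"
    by (cases u; cases v; cases w) (simp add: algebra_simps)
  show "u + v + w = u + (v + w)" by (cases u; cases v; cases w) simp
  show "u + v = v + u" by (cases u; cases v) simp
  show "0 + u = u" by (cases u) (simp add: zero_cubic_ext_def)
  show "1 * u = u" by (cases u) (simp add: one_cubic_ext_def)
  show "- u + u = 0" by (cases u) (simp add: zero_cubic_ext_def)
  show "u - v = u + - v" by (cases u; cases v) simp
  show "(0 :: 'a cubic_ext) \<noteq> 1" by (simp add: zero_cubic_ext_def one_cubic_ext_def)
qed

end

text \<open>Division with remainder of \<open>\<alpha>\<^sup>3 - \<alpha> - c\<close>, which has no root, by a representative of the given element.\<close>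

lemma cubic_ext_linear_dvd_1:
  fixes a b :: "'a :: {field, finite}"
  assumes "Cubic a b 0 \<noteq> 0"
  shows "Cubic a b 0 dvd 1"
proof (cases "b = 0")
  case True
  then have "Cubic a b 0 * Cubic (1 / a) 0 0 = 1"
    using assms by (simp add: zero_cubic_ext_def one_cubic_ext_def)
  then show ?thesis by (metis dvdI)
next
  case False
  define s where "s = - a / b"
  define e where "e = - (s ^ 3 - s - cubic_const)"
  have e: "e \<noteq> 0" using cubic_const[of s] by (simp add: e_def)
  have a: "a = - (s * b)" using False by (simp add: s_def)
  \<comment> \<open>With root \<open>s\<close> of \<open>a + b X\<close>,
    \<open>X^3 - X - c = (X - s) * (X^2 + s X + s^2 - 1) - e\<close>; thus the product is the
    constant \<open>b * e\<close>.\<close>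
  have "Cubic a b 0 * Cubic (s ^ 2 - 1) s 1 = Cubic (b * e) 0 0"
    unfolding a by (simp add: e_def algebra_simps power2_eq_square power3_eq_cube)
  then have "Cubic a b 0 * (Cubic (s ^ 2 - 1) s 1 * Cubic (1 / (b * e)) 0 0) = Cubic (b * e) 0 0 * Cubic (1 / (b * e)) 0 0"
    by (simp only: mult.assoc[symmetric])
  also have "\<dots> = 1" using e False by (simp add: one_cubic_ext_def)
  finally show ?thesis by (metis dvdI)
qed

lemma cubic_ext_dvd_1:
  fixes u :: "'a :: {field, finite} cubic_ext"
  assumes "u \<noteq> 0"
  shows "u dvd 1"
proof (cases u)
  case (Cubic a b d)
  show ?thesis
  proof (cases "d = 0")
    case True
    then show ?thesis using cubic_ext_linear_dvd_1 assms Cubic by simp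
  next
    case False
    define s where "s = b / d"
    define t where "t = a / d"
    have abd: "a = t * d" "b = s * d" using False by (simp_all add: s_def t_def)
    \<comment> \<open>Multiplication by \<open>\<alpha> - s\<close> removes the quadratic term. If
      both remaining coefficients vanished, \<open>s\<close> would be a root of
      \<open>X^3 - X - c\<close>.\<close>
    have eq: "u * Cubic (- s) 1 0 = Cubic (d * (cubic_const - s * t)) (d * (t + 1 - s ^ 2)) 0"
      unfolding Cubic abd by (simp add: algebra_simps power2_eq_square)
    have "\<not> (cubic_const = s * t \<and> t = s ^ 2 - 1)"
    proof
      assume "cubic_const = s * t \<and> t = s ^ 2 - 1"
      then have "cubic_const = s * (s ^ 2 - 1)" by metis
      also have "\<dots> = s ^ 3 - s" by (simp add: algebra_simps power2_eq_square power3_eq_cube)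
      finally show False using cubic_const[of s] by simp
    qed
    then have "u * Cubic (- s) 1 0 \<noteq> 0"
      unfolding eq zero_cubic_ext_def using False by (auto simp: eq_diff_eq)
    then have "u * Cubic (- s) 1 0 dvd 1" unfolding eq by (rule cubic_ext_linear_dvd_1)
    then show ?thesis by (rule dvd_mult_left)
  qed
qed

text \<open>The ring structure comes first because invertibility was proved by divisibility in it;
  the inverse is then chosen, sparing an explicit formula.\<close>

instantiation cubic_ext :: ("{field, finite}") field
begin

definition "inverse u = (if u = 0 then 0 else SOME v. v * u = 1)" for u :: "'a cubic_ext"
definition "u div v = u * inverse v" for u v :: "'a cubic_ext"

instance
proof
  fix u v :: "'a cubic_ext"
  show "inverse u * u = 1" if "u \<noteq> 0"
  proof -
    have "\<exists>v. v * u = 1" using cubic_ext_dvd_1[OF that] by (metis dvdE mult.commute)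
    then show ?thesis using that someI_ex[of "\<lambda>v. v * u = 1"] by (simp add: inverse_cubic_ext_def)
  qed
qed (simp_all add: divide_cubic_ext_def inverse_cubic_ext_def)

end

lemma UNIV_cubic_ext: "UNIV = (\<lambda>(a, b, d). Cubic a b d) ` (UNIV \<times> UNIV \<times> UNIV)"
  by (auto simp: image_def) (metis cubic_ext.exhaust)

instance cubic_ext :: ("{field, finite}") finite
  by standard (simp add: UNIV_cubic_ext)

lemma card_cubic_ext: "CARD('a :: {field, finite} cubic_ext) = CARD('a) ^ 3"
  unfolding UNIV_cubic_ext
  by (subst card_image) (auto simp: inj_on_def card_cartesian_product power3_eq_cube)

text \<open>The regular representation: the columns are the coordinates of the products of the
  element with \<open>1\<close> and \<open>\<alpha>\<close>, and also with
  \<open>\<alpha>\<^sup>2\<close> in the cubic case.\<close>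

fun quad_ext_mat :: "'a :: {field, finite} quad_ext \<Rightarrow> 'a mat" where
  "quad_ext_mat (Quad a b) = mat_of_rows_list 2 [[a, quad_const * b], [b, a + b]]"

fun cubic_ext_mat :: "'a :: {field, finite} cubic_ext \<Rightarrow> 'a mat" where
  "cubic_ext_mat (Cubic a b d) = mat_of_rows_list 3
    [[a, cubic_const * d, cubic_const * b], [b, a + d, cubic_const * d + b], [d, b, a + d]]"

lemma quad_ext_mat_hom:
  "quad_ext_mat u \<in> carrier_mat 2 2"
  "quad_ext_mat (u + v) = quad_ext_mat u + quad_ext_mat v"
  "quad_ext_mat (u * v) = quad_ext_mat u * quad_ext_mat v"
  "quad_ext_mat 1 = 1\<^sub>m 2"
  "quad_ext_mat (Quad e 0) = e \<cdot>\<^sub>m 1\<^sub>m 2"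
proof -
  obtain a b where u: "u = Quad a b" by (cases u)
  obtain a' b' where v: "v = Quad a' b'" by (cases v)
  show "quad_ext_mat u \<in> carrier_mat 2 2" by (rule carrier_matI) (simp_all add: u mat_of_rows_list_def)
  show "quad_ext_mat (u + v) = quad_ext_mat u + quad_ext_mat v"
    by (rule eq_matI) (auto simp: u v mat_of_rows_list_def less_Suc_eq numeral_2_eq_2 algebra_simps)
  show "quad_ext_mat (u * v) = quad_ext_mat u * quad_ext_mat v"
    by (rule eq_matI) (auto simp: u v mat_of_rows_list_def less_Suc_eq numeral_2_eq_2 scalar_prod_def algebra_simps)
  show "quad_ext_mat 1 = 1\<^sub>m 2"
    by (rule eq_matI) (auto simp: one_quad_ext_def mat_of_rows_list_def less_Suc_eq numeral_2_eq_2)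
  show "quad_ext_mat (Quad e 0) = e \<cdot>\<^sub>m 1\<^sub>m 2"
    by (rule eq_matI) (auto simp: mat_of_rows_list_def less_Suc_eq numeral_2_eq_2)
qed

lemma cubic_ext_mat_hom:
  "cubic_ext_mat u \<in> carrier_mat 3 3"
  "cubic_ext_mat (u + v) = cubic_ext_mat u + cubic_ext_mat v"
  "cubic_ext_mat (u * v) = cubic_ext_mat u * cubic_ext_mat v"
  "cubic_ext_mat 1 = 1\<^sub>m 3"
  "cubic_ext_mat (Cubic e 0 0) = e \<cdot>\<^sub>m 1\<^sub>m 3"
proof -
  obtain a b d where u: "u = Cubic a b d" by (cases u)
  obtain a' b' d' where v: "v = Cubic a' b' d'" by (cases v)
  show "cubic_ext_mat u \<in> carrier_mat 3 3" by (rule carrier_matI) (simp_all add: u mat_of_rows_list_def)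
  show "cubic_ext_mat (u + v) = cubic_ext_mat u + cubic_ext_mat v"
    by (rule eq_matI) (auto simp: u v mat_of_rows_list_def less_Suc_eq numeral_3_eq_3 algebra_simps)
  show "cubic_ext_mat (u * v) = cubic_ext_mat u * cubic_ext_mat v"
    by (rule eq_matI) (auto simp: u v mat_of_rows_list_def less_Suc_eq numeral_3_eq_3 scalar_prod_def algebra_simps)
  show "cubic_ext_mat 1 = 1\<^sub>m 3"
    by (rule eq_matI) (auto simp: one_cubic_ext_def mat_of_rows_list_def less_Suc_eq numeral_3_eq_3)
  show "cubic_ext_mat (Cubic e 0 0) = e \<cdot>\<^sub>m 1\<^sub>m 3"
    by (rule eq_matI) (auto simp: mat_of_rows_list_def less_Suc_eq numeral_3_eq_3)
qed

lemma scalar_mat_sum_of_two_powers: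
  fixes M :: "'b :: comm_ring_1 \<Rightarrow> 'a :: comm_ring_1 mat"
  assumes carrier: "\<And>u. M u \<in> carrier_mat n n" and add: "\<And>u v. M (u + v) = M u + M v"
    and mult: "\<And>u v. M (u * v) = M u * M v" and one: "M 1 = 1\<^sub>m n"
    and c: "M c = a \<cdot>\<^sub>m 1\<^sub>m n" and xy: "x ^ k + y ^ k = c"
  shows "\<exists>A \<in> carrier_mat n n. \<exists>B \<in> carrier_mat n n. a \<cdot>\<^sub>m 1\<^sub>m n = A ^\<^sub>m k + B ^\<^sub>m k"
proof -
  have pow: "M (u ^ j) = M u ^\<^sub>m j" for u j
  proof (induction j)
    case 0
    then show ?case using one carrier[of u] by simp
  next
    case (Suc j)
    then show ?case using mult[of "u ^ j" u] by (simp add: mult.commute)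
  qed
  have "a \<cdot>\<^sub>m 1\<^sub>m n = M x ^\<^sub>m k + M y ^\<^sub>m k" using c add[of "x ^ k" "y ^ k"] xy pow by simp
  then show ?thesis using carrier by blast
qed

lemma scalar_mat_sum_of_two_powers_block:
  fixes a :: "'a :: comm_ring_1"
  assumes "\<exists>A \<in> carrier_mat n n. \<exists>B \<in> carrier_mat n n. a \<cdot>\<^sub>m 1\<^sub>m n = A ^\<^sub>m k + B ^\<^sub>m k"
    and "\<exists>A \<in> carrier_mat m m. \<exists>B \<in> carrier_mat m m. a \<cdot>\<^sub>m 1\<^sub>m m = A ^\<^sub>m k + B ^\<^sub>m k"
  shows "\<exists>A \<in> carrier_mat (n + m) (n + m). \<exists>B \<in> carrier_mat (n + m) (n + m). a \<cdot>\<^sub>m 1\<^sub>m (n + m) = A ^\<^sub>m k + B ^\<^sub>m k"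
proof -
  obtain A B where AB: "A \<in> carrier_mat n n" "B \<in> carrier_mat n n" "a \<cdot>\<^sub>m 1\<^sub>m n = A ^\<^sub>m k + B ^\<^sub>m k" using assms(1) by blast
  obtain A' B' where AB': "A' \<in> carrier_mat m m" "B' \<in> carrier_mat m m" "a \<cdot>\<^sub>m 1\<^sub>m m = A' ^\<^sub>m k + B' ^\<^sub>m k" using assms(2) by blast
  let ?F = "\<lambda>X Y :: 'a mat. four_block_mat X (0\<^sub>m n m) (0\<^sub>m m n) Y"
  have "?F A A' ^\<^sub>m k + ?F B B' ^\<^sub>m k = ?F (A ^\<^sub>m k) (A' ^\<^sub>m k) + ?F (B ^\<^sub>m k) (B' ^\<^sub>m k)"
    by (simp only: pow_four_block_mat[OF AB(1) AB'(1)] pow_four_block_mat[OF AB(2) AB'(2)])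
  also have "\<dots> = four_block_mat (A ^\<^sub>m k + B ^\<^sub>m k) (0\<^sub>m n m + 0\<^sub>m n m) (0\<^sub>m m n + 0\<^sub>m m n) (A' ^\<^sub>m k + B' ^\<^sub>m k)"
    by (rule add_four_block_mat) (use AB AB' in auto)
  also have "\<dots> = ?F (a \<cdot>\<^sub>m 1\<^sub>m n) (a \<cdot>\<^sub>m 1\<^sub>m m)" using AB(3) AB'(3) by simp
  also have "\<dots> = a \<cdot>\<^sub>m 1\<^sub>m (n + m)" by (rule eq_matI) auto
  finally show ?thesis using AB AB' by (intro bexI[of _ "?F A A'"] bexI[of _ "?F B B'"]) auto
qed

lemma scalar_mat_sum_of_two_powers_of_2_3:
  fixes a :: "'a :: comm_ring_1"
  assumes "\<exists>A \<in> carrier_mat 2 2. \<exists>B \<in> carrier_mat 2 2. a \<cdot>\<^sub>m 1\<^sub>m 2 = A ^\<^sub>m k + B ^\<^sub>m k"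
    and "\<exists>A \<in> carrier_mat 3 3. \<exists>B \<in> carrier_mat 3 3. a \<cdot>\<^sub>m 1\<^sub>m 3 = A ^\<^sub>m k + B ^\<^sub>m k" and "n \<ge> 2"
  shows "\<exists>A \<in> carrier_mat n n. \<exists>B \<in> carrier_mat n n. a \<cdot>\<^sub>m 1\<^sub>m n = A ^\<^sub>m k + B ^\<^sub>m k"
  using assms(3)
proof (induction n rule: less_induct)
  case (less n)
  consider "n = 2" | "n = 3" | "n \<ge> 4" using less.prems by linarith
  then show ?case
  proof cases
    case 3
    then have "n - 2 < n" "n - 2 \<ge> 2" by auto
    moreover have "n - 2 + 2 = n" using 3 by simp
    ultimately show ?thesis using scalar_mat_sum_of_two_powers_block[OF less.IH[of "n - 2"] assms(1)] by (simp only:)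
  qed (use assms in auto)
qed

theorem theorem1p10:
  fixes p l q n k :: nat and d :: "nat \<Rightarrow> nat"
    and C :: "'a :: {field, finite} mat"
  assumes "prime p" and "q = p ^ l" and "CARD('a) = q"
    and "n \<ge> 2" and "k \<ge> 1" and "\<not> p dvd k"
    and "\<And>m. d m = gcd k (q ^ m - 1)"
    and "real q \<ge> Max {sqrt ((real (d 1) - 1) ^ 6 + 6 * real (d 1)),
                        (real (d 2) - 1) ^ 2 + 1,
                        real_of_int \<lfloor>(real (d 3) - 1) powr (4 / 3)\<rfloor> + 1}"
    and "C \<in> carrier_mat n n"
  shows "\<exists>A \<in> carrier_mat n n. \<exists>B \<in> carrier_mat n n. C = A ^\<^sub>m k + B ^\<^sub>m k"
proof -
  define D where "D m = real (d m) - 1" for m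
  have card: "CARD('a) = p ^ l" using assms(2,3) by simp
  have gcd_eq: "gcd k (CARD('a) ^ m - 1) = d m" for m using assms(3,7) by simp
  have le: "sqrt (D 1 ^ 6 + 6 * real (d 1)) \<le> real q" "(D 2)\<^sup>2 + 1 \<le> real q"
    "real_of_int \<lfloor>D 3 powr (4 / 3)\<rfloor> + 1 \<le> real q"
    using assms(8) by (simp_all add: D_def)
  have "d m > 0" for m using assms(5,7) by simp
  then have D_nonneg: "D m \<ge> 0" for m by (simp add: D_def Suc_le_eq)
  show ?thesis
  proof (cases "\<exists>a. C = a \<cdot>\<^sub>m 1\<^sub>m n")
    case False
    have "of_nat k \<noteq> (0 :: 'a)"
      using assms(6) CHAR_eq_of_card_prime_power[OF assms(1) card] by (simp add: of_nat_eq_0_iff_char_dvd)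
    moreover have "D 1 ^ 6 + 6 * real (d 1) \<le> (real q)\<^sup>2" using le(1) by (rule sqrt_le_D)
    then have "\<exists>x y z w. x \<noteq> 0 \<and> y \<noteq> 0 \<and> z \<noteq> 0 \<and> w \<noteq> 0 \<and> x ^ k + y ^ k + (z ^ k + w ^ k) = t" for t :: 'a
      using sum_of_four_nonzero_kth_powers[OF assms(1) card assms(5)] gcd_eq[of 1] assms(3) by (simp add: D_def)
    ultimately show ?thesis using nonscalar_sum_of_two_kth_powers assms(4,9) False by blast
  next
    case True
    then obtain a where a: "C = a \<cdot>\<^sub>m 1\<^sub>m n" by blast
    have "\<exists>x y. x ^ k + y ^ k = Quad a 0"
    proof (rule sum_of_two_kth_powers[OF assms(1) _ assms(5)])
      show "CARD('a quad_ext) = p ^ (l * 2)" by (simp add: card_quad_ext card power_mult)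
      \<comment> \<open>The \<open>+ 1\<close> in the second bound makes the inequality strict; its
        square is \<open>m ^ 4 < Q\<close> for \<open>Q = q^2\<close>.\<close>
      have "((D 2)\<^sup>2)\<^sup>2 < (real q)\<^sup>2" using le(2) by (intro power_strict_mono) auto
      then show "(real (gcd k (CARD('a quad_ext) - 1)) - 1) ^ 4 < real CARD('a quad_ext)"
        using gcd_eq[of 2] assms(3) by (simp add: card_quad_ext D_def flip: power_mult)
    qed
    then obtain x y where "x ^ k + y ^ k = Quad a 0" by blast
    then have two: "\<exists>A \<in> carrier_mat 2 2. \<exists>B \<in> carrier_mat 2 2. a \<cdot>\<^sub>m 1\<^sub>m 2 = A ^\<^sub>m k + B ^\<^sub>m k"
      by (rule scalar_mat_sum_of_two_powers[OF quad_ext_mat_hom])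
    have "\<exists>x y. x ^ k + y ^ k = Cubic a 0 0"
    proof (rule sum_of_two_kth_powers[OF assms(1) _ assms(5)])
      show "CARD('a cubic_ext) = p ^ (l * 3)" by (simp add: card_cubic_ext card power_mult)
      \<comment> \<open>A real number lies strictly below its floor plus one; cubing gives
        \<open>m ^ 4 < Q\<close> for \<open>Q = q^3\<close>.\<close>
      have "D 3 powr (4 / 3) < real q" using le(3) by linarith
      then have "(D 3 powr (4 / 3)) ^ 3 < real q ^ 3" by (intro power_strict_mono) auto
      moreover have "(D 3 powr (4 / 3)) ^ 3 = D 3 ^ 4"
      proof (cases "D 3 = 0")
        case False
        then have "D 3 > 0" using D_nonneg[of 3] by simp
        then show ?thesis
          using powr_powr[of "D 3" "4 / 3" 3] powr_numeral[of "D 3 powr (4 / 3)" "num.Bit1 num.One"] by simp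
      qed simp
      ultimately show "(real (gcd k (CARD('a cubic_ext) - 1)) - 1) ^ 4 < real CARD('a cubic_ext)"
        using gcd_eq[of 3] assms(3) by (simp add: card_cubic_ext D_def)
    qed
    then obtain x y where "x ^ k + y ^ k = Cubic a 0 0" by blast
    then have three: "\<exists>A \<in> carrier_mat 3 3. \<exists>B \<in> carrier_mat 3 3. a \<cdot>\<^sub>m 1\<^sub>m 3 = A ^\<^sub>m k + B ^\<^sub>m k"
      by (rule scalar_mat_sum_of_two_powers[OF cubic_ext_mat_hom])
    show ?thesis unfolding a by (rule scalar_mat_sum_of_two_powers_of_2_3[OF two three assms(4)])
  qed
qed

end
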